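(* Let $\theta=\begin{bmatrix}\alpha&\gamma\\ \beta&\delta\end{bmatrix}\in GL_2(\mathbb{Z})$ and $G=(\mathbb{Z}\oplus\mathbb{Z})\rtimes_\theta\mathbb{Z}$. The cohomology groups $H^*(G,\mathbb{Z}_2)$ are given by $$H^0(G,\mathbb{Z}_2)\cong\mathbb{Z}_2,\quad H^1(G,\mathbb{Z}_2)\cong(\mathbb{Z}_2)^{3-\mathrm{rank}_{\mathbb{Z}_2}(\theta-I)},\quad H^2(G,\mathbb{Z}_2)\cong(\mathbb{Z}_2)^{3-\mathrm{rank}_{\mathbb{Z}_2}(\theta-I)},$$ $$H^3(G,\mathbb{Z}_2)\cong\mathbb{Z}_2,\qquad H^n(G,\mathbb{Z}_2)\cong0\text{ if }n\ge4.$$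
   Context: Write $\mathbb{Z}\oplus\mathbb{Z}=\langle a,b\mid ab=ba\rangle$ and $\mathbb{Z}=\langle t\rangle$; $t$ acts on $\mathbb{Z}\oplus\mathbb{Z}$ by $a\mapsto a^\alpha b^\beta$, $b\mapsto a^\gamma b^\delta$ (this automorphism is also denoted $\theta$). $G=(\mathbb{Z}\oplus\mathbb{Z})\rtimes_\theta\mathbb{Z}=\{(a^mb^n,t^k):m,n,k\in\mathbb{Z}\}$ with product $(g,t^k)(h,t^l)=(g\,\theta^k(h),t^{k+l})$; it is the fundamental group of the torus bundle over $S^1$ determined by $\theta$. $\mathbb{Z}_2=\mathbb{Z}/2\mathbb{Z}$ is the trivial $\mathbb{Z}G$-module, $I$ is the $2\times2$ identity matrix, and $\mathrm{rank}_{\mathbb{Z}_2}(\theta-I)$ is the rank over the field $\mathbb{Z}_2$ of the reduction of $\theta-I$ mod $2$. *)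

theory Defs
  imports "HOL-Analysis.Analysis" "HOL-Algebra.Algebra" "HOL-Library.Z2"
begin

section \<open>Cohomology of a group with coefficients in a module\<close>

text \<open>
  Cohomology is computed from the standard (bar) resolution, i.e. from the complex of
  inhomogeneous cochains. \<open>G\<close> is the group, \<open>M\<close> is the coefficient group (abelian, but written
  multiplicatively, as are all groups in HOL-Algebra), and \<open>act g x\<close> is the action of \<open>g\<close> on
  \<open>x\<close> that makes \<open>M\<close> a module over the integral group ring of \<open>G\<close>.
\<close>

definition tuples :: "('g, 'a) monoid_scheme \<Rightarrow> nat \<Rightarrow> 'g list set" where
  "tuples G n = {gs. length gs = n \<and> set gs \<subseteq> carrier G}"

definition cochains ::
    "nat \<Rightarrow> ('g, 'a) monoid_scheme \<Rightarrow> ('m, 'b) monoid_scheme \<Rightarrow> ('g list \<Rightarrow> 'm) monoid" where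
  "cochains n G M = product_group (tuples G n) (\<lambda>_. M)"

text \<open>
  \<open>merge_at G i [g\<^sub>1, \<dots>, g\<^sub>m] = [g\<^sub>1, \<dots>, g\<^sub>i g\<^sub>i\<^sub>+\<^sub>1, \<dots>, g\<^sub>m]\<close> for \<open>1 \<le> i < m\<close>.
\<close>

definition merge_at :: "('g, 'a) monoid_scheme \<Rightarrow> nat \<Rightarrow> 'g list \<Rightarrow> 'g list" where
  "merge_at G i gs =
     take (i - 1) gs @ (gs ! (i - 1) \<otimes>\<^bsub>G\<^esub> gs ! i) # drop (i + 1) gs"

text \<open>
  In additive notation, \<open>(d f)(g\<^sub>1, \<dots>, g\<^sub>n\<^sub>+\<^sub>1)\<close> is
  \<open>g\<^sub>1 f(g\<^sub>2, \<dots>, g\<^sub>n\<^sub>+\<^sub>1) + (\<Sum>i=1..n. (-1)\<^sup>i f(g\<^sub>1, \<dots>, g\<^sub>i g\<^sub>i\<^sub>+\<^sub>1, \<dots>, g\<^sub>n\<^sub>+\<^sub>1)) + (-1)\<^sup>n\<^sup>+\<^sup>1 f(g\<^sub>1, \<dots>, g\<^sub>n)\<close>.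
\<close>

definition coboundary ::
    "nat \<Rightarrow> ('g, 'a) monoid_scheme \<Rightarrow> ('g \<Rightarrow> 'm \<Rightarrow> 'm) \<Rightarrow> ('m, 'b) monoid_scheme
      \<Rightarrow> ('g list \<Rightarrow> 'm) \<Rightarrow> 'g list \<Rightarrow> 'm" where
  "coboundary n G act M f =
     (\<lambda>gs \<in> tuples G (Suc n).
        act (hd gs) (f (tl gs))
        \<otimes>\<^bsub>M\<^esub> finprod M (\<lambda>i. f (merge_at G i gs) [^]\<^bsub>M\<^esub> ((- 1) ^ i :: int)) {1..n}
        \<otimes>\<^bsub>M\<^esub> f (butlast gs) [^]\<^bsub>M\<^esub> ((- 1) ^ Suc n :: int))"

definition cocycles ::
    "nat \<Rightarrow> ('g, 'a) monoid_scheme \<Rightarrow> ('g \<Rightarrow> 'm \<Rightarrow> 'm) \<Rightarrow> ('m, 'b) monoid_scheme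
      \<Rightarrow> ('g list \<Rightarrow> 'm) set" where
  "cocycles n G act M = kernel (cochains n G M) (cochains (Suc n) G M) (coboundary n G act M)"

fun coboundaries ::
    "nat \<Rightarrow> ('g, 'a) monoid_scheme \<Rightarrow> ('g \<Rightarrow> 'm \<Rightarrow> 'm) \<Rightarrow> ('m, 'b) monoid_scheme
      \<Rightarrow> ('g list \<Rightarrow> 'm) set" where
  "coboundaries 0 G act M = {\<one>\<^bsub>cochains 0 G M\<^esub>}"
| "coboundaries (Suc n) G act M = coboundary n G act M ` carrier (cochains n G M)"

definition group_cohomology ::
    "nat \<Rightarrow> ('g, 'a) monoid_scheme \<Rightarrow> ('g \<Rightarrow> 'm \<Rightarrow> 'm) \<Rightarrow> ('m, 'b) monoid_scheme
      \<Rightarrow> ('g list \<Rightarrow> 'm) set monoid" where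
  "group_cohomology n G act M =
     (cochains n G M)\<lparr>carrier := cocycles n G act M\<rparr> Mod coboundaries n G act M"

abbreviation trivial_action :: "'g \<Rightarrow> 'm \<Rightarrow> 'm" where
  "trivial_action \<equiv> \<lambda>g x. x"


section \<open>The group of a torus bundle over the circle\<close>

definition semidirect_product ::
    "('n, 'a) monoid_scheme \<Rightarrow> ('h, 'b) monoid_scheme \<Rightarrow> ('h \<Rightarrow> 'n \<Rightarrow> 'n) \<Rightarrow> ('n \<times> 'h) monoid" where
  "semidirect_product N H \<phi> =
     \<lparr>carrier = carrier N \<times> carrier H,
      monoid.mult = (\<lambda>(g, k) (h, l). (g \<otimes>\<^bsub>N\<^esub> \<phi> k h, k \<otimes>\<^bsub>H\<^esub> l)),
      one = (\<one>\<^bsub>N\<^esub>, \<one>\<^bsub>H\<^esub>)\<rparr>"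

text \<open>The pair \<open>(m, n)\<close> stands for \<open>a\<^sup>m b\<^sup>n\<close>.\<close>

abbreviation Z_plus_Z :: "(int \<times> int) monoid" where
  "Z_plus_Z \<equiv> integer_group \<times>\<times> integer_group"

text \<open>The columns of the matrix are the exponents of the images of \<open>a\<close> and \<open>b\<close>.\<close>

definition matrix_action :: "int^2^2 \<Rightarrow> int \<times> int \<Rightarrow> int \<times> int" where
  "matrix_action A = (\<lambda>(m, n). let v = A *v vector [m, n] in (v $ 1, v $ 2))"

text \<open>The integer \<open>k\<close> stands for \<open>t\<^sup>k\<close>; it acts by the \<open>k\<close>-th power in the automorphism group.\<close>

definition torus_bundle_group :: "int^2^2 \<Rightarrow> ((int \<times> int) \<times> int) monoid" where
  "torus_bundle_group A =
     semidirect_product Z_plus_Z integer_group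
       (\<lambda>k::int. matrix_action A [^]\<^bsub>AutoGroup Z_plus_Z\<^esub> k)"

definition rank_mod_2 :: "int^2^2 \<Rightarrow> nat" where
  "rank_mod_2 A = rank (map_matrix of_int A :: bit^2^2)"

abbreviation Z2_power :: "nat \<Rightarrow> (nat \<Rightarrow> int) monoid" where
  "Z2_power r \<equiv> product_group {..<r} (\<lambda>_. integer_mod_group 2)"

end

theory Submission
  imports Defs "HOL-Library.Function_Algebras"
begin

text \<open>
  For a subgroup \<open>H\<close> of \<open>G\<close> consider the complex of \<open>H\<close>-invariant functions \<open>G\<^sup>n\<^sup>+\<^sup>1 \<rightarrow> \<int>/2\<close>, with the
  homogeneous differential; since \<open>H\<close> acts freely on \<open>G\<close>, it computes \<open>H\<^sup>*(H, \<int>/2)\<close>. If \<open>t\<close> normalizes \<open>H\<close>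
  and generates an infinite cyclic quotient over it, then \<open>t - 1\<close> maps this complex onto itself, and
  its kernel is the complex of \<open>\<langle>H, t\<rangle>\<close>. In the resulting long exact sequence the order of the \<open>n\<close>-th
  cohomology of \<open>\<langle>H, t\<rangle>\<close> is \<open>k\<^sub>n\<^sub>-\<^sub>1 k\<^sub>n\<close>, where \<open>k\<^sub>n\<close> is the order of the \<open>t\<close>-invariants in the \<open>n\<close>-th cohomology
  of \<open>H\<close>, because the kernel and cokernel of \<open>t - 1\<close> on a finite group have the same order.

  Starting from the trivial group, whose complex is contractible, one adjoins \<open>a\<close>, \<open>b\<close> and \<open>t\<close> in
  turn. The action on a group of order at most two is trivial, so the only unknown is \<open>k\<^sub>1\<close> in the
  last step. It occurs in both \<open>H\<^sup>1\<close> and \<open>H\<^sup>2\<close>, and is determined by counting \<open>Hom(G, \<int>/2)\<close>. All groups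
  have exponent two, so their orders determine them.
\<close>

section \<open>Indices of additive subgroups\<close>

definition add_subgroup :: "'a::ab_group_add set \<Rightarrow> bool" where
  "add_subgroup A \<longleftrightarrow> 0 \<in> A \<and> (\<forall>x\<in>A. \<forall>y\<in>A. x - y \<in> A)"

text \<open>For subgroups, the value 0 means that there are infinitely many cosets, so positivity of
  an index expresses finiteness.\<close>

definition coset_index :: "'a::ab_group_add set \<Rightarrow> 'a set \<Rightarrow> nat" where
  "coset_index A B = card ((\<lambda>x. (+) x ` B) ` A)"

lemma add_subgroup_zero: "add_subgroup A \<Longrightarrow> 0 \<in> A"
  by (simp add: add_subgroup_def)

lemma add_subgroup_diff: "add_subgroup A \<Longrightarrow> x \<in> A \<Longrightarrow> y \<in> A \<Longrightarrow> x - y \<in> A"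
  by (simp add: add_subgroup_def)

lemma add_subgroup_uminus: "add_subgroup A \<Longrightarrow> x \<in> A \<Longrightarrow> - x \<in> A"
  using add_subgroup_diff[of A 0 x] by (simp add: add_subgroup_zero)

lemma add_subgroup_add: "add_subgroup A \<Longrightarrow> x \<in> A \<Longrightarrow> y \<in> A \<Longrightarrow> x + y \<in> A"
  using add_subgroup_diff[of A x "- y"] by (simp add: add_subgroup_uminus)

lemma add_coset_eq_iff:
  assumes B: "add_subgroup B"
  shows "(+) x ` B = (+) y ` B \<longleftrightarrow> x - y \<in> B"
proof
  assume "(+) x ` B = (+) y ` B"
  moreover have "x \<in> (+) x ` B"
    by (rule image_eqI[where x = 0]) (simp_all add: add_subgroup_zero[OF B])
  ultimately show "x - y \<in> B" by auto
next
  have sub: "(+) u ` B \<subseteq> (+) v ` B" if "u - v \<in> B" for u v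
  proof
    fix z assume "z \<in> (+) u ` B"
    then obtain b where b: "b \<in> B" "z = u + b" by auto
    then have "z = v + ((u - v) + b)" by simp
    then show "z \<in> (+) v ` B"
      by (rule image_eqI) (rule add_subgroup_add[OF B that b(1)])
  qed
  assume *: "x - y \<in> B"
  then have "y - x \<in> B"
    using add_subgroup_uminus[OF B *] by simp
  with * show "(+) x ` B = (+) y ` B"
    using sub[of x y] sub[of y x] by (simp only: set_eq_subset)
qed

text \<open>The two images stand for sets of classes. The second assumption makes the map of classes
  induced by \<open>f\<close> well defined and injective, the third makes it onto. Quotients can
  thus be compared without constructing quotient groups.\<close>

lemma card_image_transfer:
  assumes "\<And>x. x \<in> A \<Longrightarrow> f x \<in> A'"
    and "\<And>x y. x \<in> A \<Longrightarrow> y \<in> A \<Longrightarrow> g x = g y \<longleftrightarrow> g' (f x) = g' (f y)"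
    and "\<And>y. y \<in> A' \<Longrightarrow> \<exists>x\<in>A. g' (f x) = g' y"
  shows "card (g ` A) = card (g' ` A')"
proof -
  have img: "g' ` A' = (\<lambda>x. g' (f x)) ` A"
  proof (intro equalityI subsetI)
    fix z assume "z \<in> g' ` A'"
    then show "z \<in> (\<lambda>x. g' (f x)) ` A" using assms(3) by (metis imageE imageI)
  next
    fix z assume "z \<in> (\<lambda>x. g' (f x)) ` A"
    then show "z \<in> g' ` A'" using assms(1) by blast
  qed
  let ?r = "\<lambda>c. g' (f (inv_into A g c))"
  have r: "?r (g x) = g' (f x)" if "x \<in> A" for x
    using assms(2)[of "inv_into A g (g x)" x] that by (simp add: inv_into_into f_inv_into_f)
  have "bij_betw ?r (g ` A) (g' ` A')"
    unfolding bij_betw_def inj_on_def img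
    using r assms(2) by (auto simp: image_iff)
  then show ?thesis by (rule bij_betw_same_card)
qed

text \<open>Counting form of an isomorphism theorem: on \<open>A\<close>, membership in
  \<open>B\<close> is detected by \<open>f\<close> and \<open>B'\<close>, and every class of
  \<open>A'\<close> modulo \<open>B'\<close> is reached, so \<open>f\<close> induces a bijection of
  classes.\<close>

lemma coset_index_transfer:
  assumes "add_subgroup B" "add_subgroup B'"
    and "\<And>x y. f (x - y) = f x - f y"
    and "\<And>x. x \<in> A \<Longrightarrow> f x \<in> A'"
    and "\<And>x y. x \<in> A \<Longrightarrow> y \<in> A \<Longrightarrow> x - y \<in> A"
    and "\<And>x. x \<in> A \<Longrightarrow> f x \<in> B' \<longleftrightarrow> x \<in> B"
    and "\<And>y. y \<in> A' \<Longrightarrow> \<exists>x\<in>A. f x - y \<in> B'"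
  shows "coset_index A B = coset_index A' B'"
  unfolding coset_index_def
proof (rule card_image_transfer[where f = f])
  show "(+) x ` B = (+) y ` B \<longleftrightarrow> (+) (f x) ` B' = (+) (f y) ` B'" if "x \<in> A" "y \<in> A" for x y
    using assms(5,6) that
    by (simp only: add_coset_eq_iff[OF assms(1)] add_coset_eq_iff[OF assms(2)] assms(3)[symmetric])
  show "\<exists>x\<in>A. (+) (f x) ` B' = (+) y ` B'" if "y \<in> A'" for y
    using assms(7)[OF that] by (simp only: add_coset_eq_iff[OF assms(2)])
qed (rule assms(4))

text \<open>Once a representative \<open>r x\<close> is chosen in each \<open>K\<close>-coset, the
  class of \<open>x\<close> modulo \<open>B\<close> corresponds to its class modulo \<open>K\<close>
  together with the class of \<open>x - r x\<close> modulo \<open>B\<close>. Infinite indices are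
  covered, since \<open>card\<close> then gives 0 on both sides.\<close>

lemma coset_index_mult:
  assumes A: "add_subgroup A" and K: "add_subgroup K" and B: "add_subgroup B"
    and "B \<subseteq> K" "K \<subseteq> A"
  shows "coset_index A B = coset_index A K * coset_index K B"
proof -
  define r where "r = (\<lambda>x. SOME y. y \<in> A \<and> x - y \<in> K)"
  have r: "r x \<in> A \<and> x - r x \<in> K" if "x \<in> A" for x
    unfolding r_def
    by (rule someI[where x = x]) (use that K in \<open>simp add: add_subgroup_zero\<close>)
  have r_eq: "r x = r y" if "x - y \<in> K" for x y
  proof -
    have "x - z \<in> K \<longleftrightarrow> y - z \<in> K" for z
    proof
      assume "x - z \<in> K"
      then have "(x - z) - (x - y) \<in> K" using K that add_subgroup_diff by blast
      then show "y - z \<in> K" by simp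
    next
      assume "y - z \<in> K"
      then have "(y - z) + (x - y) \<in> K" using K that add_subgroup_add by blast
      then show "x - z \<in> K" by simp
    qed
    then show ?thesis by (simp add: r_def)
  qed
  let ?g = "\<lambda>(x, y). ((+) x ` K, (+) y ` B)"
  have "card ((\<lambda>x. (+) x ` B) ` A) = card (?g ` (A \<times> K))"
  proof (rule card_image_transfer[where f = "\<lambda>x. (x, x - r x)"])
    fix x assume "x \<in> A"
    then show "(x, x - r x) \<in> A \<times> K" using r by blast
  next
    fix x y assume "x \<in> A" "y \<in> A"
    have "x - y \<in> B \<longleftrightarrow> x - y \<in> K \<and> (x - r x) - (y - r y) \<in> B"
      using r_eq[of x y] \<open>B \<subseteq> K\<close> by (auto simp: algebra_simps)
    then show "(+) x ` B = (+) y ` B \<longleftrightarrow> ?g (x, x - r x) = ?g (y, y - r y)"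
      by (simp add: add_coset_eq_iff[OF B] add_coset_eq_iff[OF K])
  next
    fix p assume "p \<in> A \<times> K"
    then obtain x k where p: "p = (x, k)" and x: "x \<in> A" and k: "k \<in> K" by blast
    \<comment> \<open>The pair \<open>(x, k)\<close> is attained at this element: its representative
      is again \<open>r x\<close>, and its remainder is \<open>k\<close>.\<close>
    let ?z = "r x + k"
    have z: "?z \<in> A" using A r[OF x] k \<open>K \<subseteq> A\<close> by (blast intro: add_subgroup_add)
    have "?z - x = k - (x - r x)" by simp
    then have zx: "?z - x \<in> K" using K k r[OF x] add_subgroup_diff by metis
    then have "r ?z = r x" by (rule r_eq)
    then have "?g (?z, ?z - r ?z) = ?g p"
      using zx by (simp add: p add_coset_eq_iff[OF K])
    with z show "\<exists>z\<in>A. ?g (z, z - r z) = ?g p" by blast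
  qed
  also have "?g ` (A \<times> K) = (\<lambda>x. (+) x ` K) ` A \<times> (\<lambda>x. (+) x ` B) ` K"
    by auto
  finally show ?thesis by (simp add: coset_index_def card_cartesian_product)
qed

lemma coset_index_self:
  assumes A: "add_subgroup A"
  shows "coset_index A A = 1"
proof -
  have "(+) x ` A = A" if "x \<in> A" for x
    using add_coset_eq_iff[OF A, of x 0] that by simp
  then have "(\<lambda>x. (+) x ` A) ` A = {A}"
    using add_subgroup_zero[OF A] by (simp add: image_constant_conv cong: image_cong) auto
  then show ?thesis by (simp add: coset_index_def)
qed

lemma coset_index_zero: "coset_index A {0} = card A"
  by (simp add: coset_index_def card_image inj_on_def)

section \<open>Counting in the long exact sequence\<close>

definition cocycle_group :: "('a::ab_group_add \<Rightarrow> 'a) \<Rightarrow> (nat \<Rightarrow> 'a set) \<Rightarrow> nat \<Rightarrow> 'a set" where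
  "cocycle_group d E n = {x \<in> E n. d x = 0}"

definition coboundary_group :: "('a::ab_group_add \<Rightarrow> 'a) \<Rightarrow> (nat \<Rightarrow> 'a set) \<Rightarrow> nat \<Rightarrow> 'a set" where
  "coboundary_group d E n = (case n of 0 \<Rightarrow> {0} | Suc m \<Rightarrow> d ` E m)"

text \<open>In a cochain complex, the value 0 stands for an infinite cohomology group.\<close>

definition cohomology_order :: "('a::ab_group_add \<Rightarrow> 'a) \<Rightarrow> (nat \<Rightarrow> 'a set) \<Rightarrow> nat \<Rightarrow> nat" where
  "cohomology_order d E n = coset_index (cocycle_group d E n) (coboundary_group d E n)"

text \<open>All degrees sit inside one ambient group with a single map \<open>d\<close>; only the
  subgroups \<open>E n\<close> carry the grading.\<close>

locale cochain_complex =
  fixes d :: "'a::ab_group_add \<Rightarrow> 'a" and E :: "nat \<Rightarrow> 'a set"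
  assumes add_subgroup_E: "add_subgroup (E n)"
    and d_diff: "d (x - y) = d x - d y"
    and d_closed: "x \<in> E n \<Longrightarrow> d x \<in> E (Suc n)"
    and d_d: "d (d x) = 0"
begin

abbreviation "Z \<equiv> cocycle_group d E"
abbreviation "B \<equiv> coboundary_group d E"

lemma d_zero: "d 0 = 0"
  using d_diff[of 0 0] by simp

lemma add_subgroup_Z: "add_subgroup (Z n)"
  using add_subgroup_E[of n] by (simp add: add_subgroup_def cocycle_group_def d_diff d_zero)

lemma add_subgroup_B: "add_subgroup (B n)"
proof (cases n)
  case 0
  then show ?thesis by (simp add: add_subgroup_def coboundary_group_def)
next
  case (Suc m)
  have "d x - d y \<in> d ` E m" if "x \<in> E m" "y \<in> E m" for x y
    using that add_subgroup_diff[OF add_subgroup_E] by (simp flip: d_diff)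
  moreover have "0 \<in> d ` E m"
    using add_subgroup_zero[OF add_subgroup_E] d_zero by (metis imageI)
  ultimately show ?thesis by (auto simp: Suc add_subgroup_def coboundary_group_def)
qed

lemma B_subset_Z: "B n \<subseteq> Z n"
  using add_subgroup_zero[OF add_subgroup_E]
  by (auto simp: coboundary_group_def cocycle_group_def d_d d_zero d_closed split: nat.splits)

end

section \<open>The kernel of a surjective endomorphism of a complex\<close>

locale surjective_endomorphism = cochain_complex +
  fixes T :: "'a \<Rightarrow> 'a"
  assumes T_diff: "T (x - y) = T x - T y"
    and T_closed: "x \<in> E n \<Longrightarrow> T x \<in> E n"
    and T_surj: "y \<in> E n \<Longrightarrow> \<exists>x\<in>E n. T x = y"
    and T_d: "T (d x) = d (T x)"
begin

text \<open>Surjectivity of \<open>T\<close> makes 0 -> F -> E -> E -> 0 a short exact sequence of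
  complexes; the index lemmas below are its long exact sequence in terms of orders.\<close>

definition F :: "nat \<Rightarrow> 'a set" where
  "F n = {x \<in> E n. T x = 0}"

text \<open>Modulo \<open>B n\<close> this is the kernel of the map that \<open>T\<close> induces on
  the \<open>n\<close>-th cohomology.\<close>

definition K :: "nat \<Rightarrow> 'a set" where
  "K n = {z \<in> Z n. T z \<in> B n}"

lemma T_zero: "T 0 = 0"
  using T_diff[of 0 0] by simp

lemma T_add: "T (x + y) = T x + T y"
  using T_diff[of x "0 - y"] T_diff[of 0 y] by (simp add: T_zero)

lemma d_add: "d (x + y) = d x + d y"
  using d_diff[of x "0 - y"] d_diff[of 0 y] by (simp add: d_zero)

sublocale F: cochain_complex d F
proof
  show "add_subgroup (F n)" for n
    using add_subgroup_E[of n] by (simp add: add_subgroup_def F_def T_diff T_zero)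
  show "d x \<in> F (Suc n)" if "x \<in> F n" for x n
    using that by (simp add: F_def d_closed T_d d_zero)
qed (simp_all add: d_diff d_d)

lemma F_subset: "F n \<subseteq> E n"
  by (auto simp: F_def)

lemma T_Z: "z \<in> Z n \<Longrightarrow> T z \<in> Z n"
  by (simp add: cocycle_group_def T_closed d_zero flip: T_d) (simp add: T_zero)

lemma T_B: "b \<in> B n \<Longrightarrow> T b \<in> B n"
  by (auto simp: coboundary_group_def T_d T_zero T_closed split: nat.splits)

lemma add_subgroup_K: "add_subgroup (K n)"
  using add_subgroup_Z[of n] add_subgroup_B[of n]
  by (simp add: add_subgroup_def K_def T_diff T_zero)

lemma B_subset_K: "B n \<subseteq> K n"
  using B_subset_Z T_B by (auto simp: K_def)

lemma K_subset_Z: "K n \<subseteq> Z n"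
  by (auto simp: K_def)

text \<open>Modulo \<open>B n\<close> this is the image of the map induced by \<open>T\<close> on
  cohomology, so its index in \<open>Z n\<close> is the order of the cokernel.\<close>

definition TZB :: "nat \<Rightarrow> 'a set" where
  "TZB n = {T z + b | z b. z \<in> Z n \<and> b \<in> B n}"

lemma add_subgroup_TZB: "add_subgroup (TZB n)"
  unfolding add_subgroup_def
proof (intro conjI ballI)
  have "0 = T 0 + 0" by (simp add: T_zero)
  then show "0 \<in> TZB n"
    using add_subgroup_zero[OF add_subgroup_Z] add_subgroup_zero[OF add_subgroup_B]
    unfolding TZB_def by blast
next
  fix x y assume "x \<in> TZB n" "y \<in> TZB n"
  then obtain z b z' b' where "x = T z + b" "y = T z' + b'" and *: "z \<in> Z n" "b \<in> B n" "z' \<in> Z n" "b' \<in> B n"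
    unfolding TZB_def by blast
  then have "x - y = T (z - z') + (b - b')" by (simp add: T_diff)
  then show "x - y \<in> TZB n"
    using * add_subgroup_diff[OF add_subgroup_Z] add_subgroup_diff[OF add_subgroup_B]
    unfolding TZB_def by blast
qed

lemma B_subset_TZB: "B n \<subseteq> TZB n"
proof
  fix b assume "b \<in> B n"
  moreover have "b = T 0 + b" by (simp add: T_zero)
  ultimately show "b \<in> TZB n"
    using add_subgroup_zero[OF add_subgroup_Z] unfolding TZB_def by blast
qed

lemma TZB_subset_Z: "TZB n \<subseteq> Z n"
  unfolding TZB_def using T_Z B_subset_Z add_subgroup_add[OF add_subgroup_Z] by blast

lemma Z_index: "cohomology_order d E n = coset_index (Z n) (K n) * coset_index (K n) (B n)"
  unfolding cohomology_order_def
  by (rule coset_index_mult[OF add_subgroup_Z add_subgroup_K add_subgroup_B B_subset_K K_subset_Z])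

text \<open>An endomorphism of a finite group has kernel and cokernel of the same order.\<close>

lemma coker_index:
  assumes "cohomology_order d E n > 0"
  shows "coset_index (Z n) (TZB n) = coset_index (K n) (B n)"
proof -
  \<comment> \<open>\<open>T\<close> induces a bijection from Z/K onto the image TZB/B. This common
    factor is then cancelled from two factorisations of the order of Z/B, which is legitimate
    because that order is positive.\<close>
  have "coset_index (Z n) (K n) = coset_index (TZB n) (B n)"
  proof (rule coset_index_transfer[OF add_subgroup_K add_subgroup_B, where f = T])
    show "T x \<in> TZB n" if "x \<in> Z n" for x
    proof -
      have "T x = T x + 0" by simp
      then show ?thesis
        using that add_subgroup_zero[OF add_subgroup_B] unfolding TZB_def by blast
    qed
    show "\<exists>x\<in>Z n. T x - y \<in> B n" if "y \<in> TZB n" for y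
    proof -
      obtain z b where "y = T z + b" "z \<in> Z n" "b \<in> B n" using \<open>y \<in> TZB n\<close> unfolding TZB_def by blast
      then show ?thesis
        using add_subgroup_uminus[OF add_subgroup_B] by (intro bexI[of _ z]) auto
    qed
  qed (auto simp: T_diff K_def intro: add_subgroup_diff[OF add_subgroup_Z])
  moreover have "cohomology_order d E n = coset_index (Z n) (TZB n) * coset_index (TZB n) (B n)"
    unfolding cohomology_order_def
    by (rule coset_index_mult[OF add_subgroup_Z add_subgroup_TZB add_subgroup_B B_subset_TZB TZB_subset_Z])
  ultimately show ?thesis
    using Z_index[of n] assms by auto
qed

text \<open>Exactness at the cohomology of \<open>E\<close>: the left-hand side is the order of the
  image of the \<open>n\<close>-th cohomology of \<open>F\<close> in that of \<open>E\<close>, and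
  this image is the kernel of the induced map of \<open>T\<close>.\<close>

lemma image_index:
  "coset_index (F.Z n) (F.Z n \<inter> B n) = coset_index (K n) (B n)"
proof (rule coset_index_transfer[where f = "\<lambda>x. x"])
  show "add_subgroup (F.Z n \<inter> B n)"
    using F.add_subgroup_Z[of n] add_subgroup_B[of n] by (simp add: add_subgroup_def)
  show "x \<in> K n" if "x \<in> F.Z n" for x
    using that add_subgroup_zero[OF add_subgroup_B] by (simp add: K_def cocycle_group_def F_def)
  show "\<exists>x\<in>F.Z n. x - y \<in> B n" if y: "y \<in> K n" for y
  proof (cases n)
    case 0
    then show ?thesis
      using y by (intro bexI[of _ y]) (auto simp: K_def cocycle_group_def F_def coboundary_group_def)
  next
    case (Suc m)
    then obtain w where w: "w \<in> E m" "T y = d w"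
      using y by (auto simp: K_def coboundary_group_def)
    \<comment> \<open>Lifting \<open>w\<close> through \<open>T\<close> corrects \<open>y\<close> by
      a coboundary to the cocycle \<open>y - d v\<close>, which \<open>T\<close> kills.\<close>
    obtain v where v: "v \<in> E m" "T v = w" using T_surj w by blast
    have "y - d v \<in> F.Z n"
      using y v w d_closed[OF v(1)] add_subgroup_diff[OF add_subgroup_E]
      by (auto simp: K_def cocycle_group_def F_def T_diff T_d d_diff d_d Suc)
    moreover have "(y - d v) - y \<in> B n"
      using add_subgroup_uminus[OF add_subgroup_B, of "d v" n] v by (simp add: Suc coboundary_group_def)
    ultimately show ?thesis by blast
  qed
qed (auto simp: add_subgroup_B intro: add_subgroup_diff[OF F.add_subgroup_Z])

text \<open>The connecting map identifies the cokernel of \<open>T\<close> in degree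
  \<open>n\<close> with the classes of \<open>F\<close> in degree \<open>n + 1\<close> that vanish
  in \<open>E\<close>. Instead of inverting \<open>T\<close>, both sides are compared with the
  quotient of \<open>W\<close> by \<open>V\<close>: one comparison is induced by \<open>d\<close>,
  the other by \<open>T\<close>.\<close>

lemma connecting_index:
  "coset_index (F.Z (Suc n) \<inter> B (Suc n)) (F.B (Suc n)) = coset_index (Z n) (TZB n)"
proof -
  define W where "W = {w \<in> E n. d (T w) = 0}"
  define V where "V = {z + c | z c. z \<in> Z n \<and> c \<in> F n}"
  have W_diff: "x - y \<in> W" if "x \<in> W" "y \<in> W" for x y
    using that add_subgroup_diff[OF add_subgroup_E] by (simp add: W_def T_diff d_diff)
  have V: "add_subgroup V"
    unfolding add_subgroup_def
  proof (intro conjI ballI)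
    have "0 = 0 + (0 :: 'a)" by simp
    then show "0 \<in> V"
      using add_subgroup_zero[OF add_subgroup_Z] add_subgroup_zero[OF F.add_subgroup_E]
      unfolding V_def by blast
  next
    fix x y assume "x \<in> V" "y \<in> V"
    then obtain z b z' b' where "x = z + b" "y = z' + b'" and *: "z \<in> Z n" "b \<in> F n" "z' \<in> Z n" "b' \<in> F n"
      unfolding V_def by blast
    then have "x - y = (z - z') + (b - b')" by simp
    then show "x - y \<in> V"
      using * add_subgroup_diff[OF add_subgroup_Z] add_subgroup_diff[OF F.add_subgroup_E]
      unfolding V_def by blast
  qed
  have "coset_index W V = coset_index (F.Z (Suc n) \<inter> B (Suc n)) (F.B (Suc n))"
  proof (rule coset_index_transfer[OF V F.add_subgroup_B, where f = d])
    show "d x \<in> F.Z (Suc n) \<inter> B (Suc n)" if "x \<in> W" for x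
      using that d_closed by (simp add: W_def cocycle_group_def F_def coboundary_group_def T_d d_d)
    show "d x \<in> F.B (Suc n) \<longleftrightarrow> x \<in> V" if x: "x \<in> W" for x
    proof
      assume "d x \<in> F.B (Suc n)"
      then obtain c where c: "c \<in> F n" "d x = d c" by (auto simp: coboundary_group_def)
      then have "x - c \<in> Z n"
        using x c F_subset add_subgroup_diff[OF add_subgroup_E, of x n c]
        by (auto simp: cocycle_group_def d_diff W_def)
      moreover have "x = (x - c) + c" by simp
      ultimately show "x \<in> V" using c(1) unfolding V_def by blast
    next
      assume "x \<in> V"
      then show "d x \<in> F.B (Suc n)"
        by (auto simp: V_def coboundary_group_def cocycle_group_def d_add)
    qed
    show "\<exists>x\<in>W. d x - y \<in> F.B (Suc n)" if y: "y \<in> F.Z (Suc n) \<inter> B (Suc n)" for y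
    proof -
      obtain w where "w \<in> E n" "y = d w" using y by (auto simp: coboundary_group_def)
      then show ?thesis
        using y add_subgroup_zero[OF F.add_subgroup_B]
        by (intro bexI[of _ w]) (simp_all add: W_def cocycle_group_def F_def flip: T_d)
    qed
  qed (auto simp: d_diff intro: W_diff)
  moreover have "coset_index W V = coset_index (Z n) (TZB n)"
  proof (rule coset_index_transfer[OF V add_subgroup_TZB, where f = T])
    show "T x \<in> Z n" if "x \<in> W" for x
      using that T_closed by (simp add: W_def cocycle_group_def)
    show "T x \<in> TZB n \<longleftrightarrow> x \<in> V" if x: "x \<in> W" for x
    proof
      assume "T x \<in> TZB n"
      then obtain z b where zb: "T x = T z + b" "z \<in> Z n" "b \<in> B n" unfolding TZB_def by blast
      \<comment> \<open>The coboundary \<open>b\<close> is itself \<open>T\<close> of a coboundary,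
        because a primitive of \<open>b\<close> lifts through \<open>T\<close>. Hence
        \<open>x - (z + u)\<close> is killed by \<open>T\<close>, which splits \<open>x\<close> as
        required by \<open>V\<close>.\<close>
      obtain u where u: "u \<in> B n" "T u = b"
      proof (cases n)
        case 0
        then show ?thesis using that[of 0] zb by (simp add: coboundary_group_def T_zero)
      next
        case (Suc m)
        then obtain v where "v \<in> E m" "b = d v" using zb by (auto simp: coboundary_group_def)
        moreover obtain v' where "v' \<in> E m" "T v' = v" using T_surj calculation by blast
        ultimately show ?thesis using that[of "d v'"] by (simp add: Suc coboundary_group_def T_d)
      qed
      have zu: "z + u \<in> Z n"
        using zb u B_subset_Z add_subgroup_add[OF add_subgroup_Z] by blast
      then have "x - (z + u) \<in> F n"
        using x zb u add_subgroup_diff[OF add_subgroup_E]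
        by (simp add: F_def T_diff T_add W_def cocycle_group_def)
      moreover have "x = (z + u) + (x - (z + u))" by simp
      ultimately show "x \<in> V" using zu unfolding V_def by blast
    next
      assume "x \<in> V"
      then obtain z c where "x = z + c" "z \<in> Z n" "c \<in> F n" unfolding V_def by blast
      then have "T x = T z + 0" "z \<in> Z n" by (auto simp: F_def T_add)
      then show "T x \<in> TZB n"
        using add_subgroup_zero[OF add_subgroup_B] unfolding TZB_def by blast
    qed
    show "\<exists>x\<in>W. T x - y \<in> TZB n" if y: "y \<in> Z n" for y
    proof -
      obtain w where "w \<in> E n" "T w = y" using y T_surj by (auto simp: cocycle_group_def)
      then show ?thesis
        using y add_subgroup_zero[OF add_subgroup_TZB]
        by (intro bexI[of _ w]) (auto simp: W_def cocycle_group_def)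
    qed
  qed (auto simp: T_diff intro: W_diff)
  ultimately show ?thesis by simp
qed

text \<open>In degree 0 only 0 is a coboundary, so the cohomology of \<open>F\<close> embeds in that
  of \<open>E\<close>.\<close>

lemma cohomology_order_F_0: "cohomology_order d F 0 = coset_index (K 0) (B 0)"
proof -
  have "F.Z 0 \<inter> B 0 = F.B 0"
    using add_subgroup_zero[OF F.add_subgroup_Z] by (auto simp: coboundary_group_def)
  then show ?thesis
    using image_index[of 0] by (simp add: cohomology_order_def)
qed

text \<open>The map from the cohomology of \<open>F\<close> to that of \<open>E\<close> has as
  kernel the cokernel of \<open>T\<close> one degree lower and as image the kernel of
  \<open>T\<close> in the same degree. Finiteness turns the order of the cokernel into that of a
  kernel.\<close>

lemma cohomology_order_F_Suc:
  assumes "cohomology_order d E n > 0"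
  shows "cohomology_order d F (Suc n) =
    coset_index (K n) (B n) * coset_index (K (Suc n)) (B (Suc n))"
proof -
  have "add_subgroup (F.Z (Suc n) \<inter> B (Suc n))"
    using F.add_subgroup_Z[of "Suc n"] add_subgroup_B[of "Suc n"] by (simp add: add_subgroup_def)
  moreover have "F.B (Suc n) \<subseteq> F.Z (Suc n) \<inter> B (Suc n)"
    using F.B_subset_Z F_subset by (fastforce simp: coboundary_group_def)
  ultimately have "cohomology_order d F (Suc n) =
      coset_index (F.Z (Suc n)) (F.Z (Suc n) \<inter> B (Suc n)) *
      coset_index (F.Z (Suc n) \<inter> B (Suc n)) (F.B (Suc n))"
    unfolding cohomology_order_def
    by (intro coset_index_mult) (auto intro: F.add_subgroup_Z F.add_subgroup_B)
  then show ?thesis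
    using image_index connecting_index coker_index[OF assms] by simp
qed

text \<open>
  On a group of order at most two every automorphism is the identity, so \<open>T\<close> acts as zero if
  \<open>T + 1\<close> induces an injection.
\<close>

lemma K_index_small:
  assumes "cohomology_order d E n \<in> {1, 2}"
    and "\<And>z. z \<in> Z n \<Longrightarrow> T z + z \<in> B n \<Longrightarrow> z \<in> B n"
  shows "coset_index (K n) (B n) = cohomology_order d E n"
proof -
  let ?c = "\<lambda>x. (+) x ` B n"
  let ?Q = "?c ` Z n"
  have eq: "?c x = ?c y \<longleftrightarrow> x - y \<in> B n" for x y
    by (rule add_coset_eq_iff[OF add_subgroup_B])
  have card: "card ?Q \<in> {1, 2}" using assms(1) by (simp add: cohomology_order_def coset_index_def)
  then have fin: "finite ?Q" by (metis card.infinite insertE empty_iff zero_neq_one zero_neq_numeral)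
  have "T z \<in> B n" if z: "z \<in> Z n" for z
  proof (rule ccontr)
    assume nB: "T z \<notin> B n"
    have zB: "z \<notin> B n" using nB T_B by blast
    have TzZ: "T z + z \<in> Z n" using z T_Z add_subgroup_add[OF add_subgroup_Z] by blast
    have TB: "T z + z \<notin> B n" using assms(2) z zB by blast
    have neg: "- x \<in> B n \<longleftrightarrow> x \<in> B n" for x
      using add_subgroup_uminus[OF add_subgroup_B, of x n] add_subgroup_uminus[OF add_subgroup_B, of "- x" n] by auto
    \<comment> \<open>If the class of \<open>T z\<close> were nonzero, the classes of 0,
      \<open>z\<close> and \<open>T z + z\<close> would be three distinct ones.\<close>
    have "0 - z = - z" "0 - (T z + z) = - (T z + z)" "z - (T z + z) = - T z" by simp_all
    then have "?c 0 \<noteq> ?c z" "?c 0 \<noteq> ?c (T z + z)" "?c z \<noteq> ?c (T z + z)"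
      unfolding eq using nB zB TB neg by metis+
    then have "card {?c 0, ?c z, ?c (T z + z)} = 3" by simp
    moreover have "{?c 0, ?c z, ?c (T z + z)} \<subseteq> ?Q"
      using z TzZ add_subgroup_zero[OF add_subgroup_Z] by blast
    ultimately have "3 \<le> card ?Q" using card_mono[OF fin] by metis
    then show False using card by auto
  qed
  then have "K n = Z n" by (auto simp: K_def)
  then show ?thesis by (simp add: cohomology_order_def)
qed

end

section \<open>Homogeneous cochains modulo two\<close>

text \<open>
  On lists of length \<open>n + 1\<close>, \<open>list_diff f\<close> is the sum over all \<open>i\<close> of the values of \<open>f\<close> on the list
  with its \<open>i\<close>-th entry removed.
\<close>

fun list_diff :: "('x list \<Rightarrow> bit) \<Rightarrow> 'x list \<Rightarrow> bit" where
  "list_diff f [] = 0"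
| "list_diff f (x # xs) = f xs + list_diff (\<lambda>ys. f (x # ys)) xs"

text \<open>Sums and products of bits stay in ring form, rather than being rewritten to
  \<open>xor\<close> and \<open>and\<close>.\<close>

declare add_bit_eq_xor [simp del] mult_bit_eq_and [simp del] minus_bit_def [simp del] uminus_bit_def [simp del]

lemma bit_add_self: "(x :: bit) + x = 0"
  by (cases x) simp_all

lemma bit_add_eq_0_iff: "(x :: bit) + y = 0 \<longleftrightarrow> x = y"
  by (cases x; cases y) simp_all

lemma bit_diff_eq_add: "(x :: bit) - y = x + y"
  by (simp add: minus_bit_def)

lemma list_diff_add: "list_diff (\<lambda>ys. f ys + g ys) xs = list_diff f xs + list_diff g xs"
  by (induction xs arbitrary: f g) (simp_all add: algebra_simps)

lemma list_diff_zero: "list_diff (\<lambda>ys. 0) xs = 0"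
  by (induction xs) simp_all

lemma list_diff_diff: "list_diff (f - g) = list_diff f - list_diff g"
  using list_diff_add[of f g] by (simp add: fun_diff_def bit_diff_eq_add fun_eq_iff)

text \<open>The head can be removed first or second; the two contributions are equal and cancel
  modulo two. What remains keeps the head and is covered by induction.\<close>

lemma list_diff_list_diff: "list_diff (list_diff f) = 0"
proof
  fix xs
  show "list_diff (list_diff f) xs = 0 xs"
  proof (induction xs arbitrary: f)
    case (Cons x xs)
    have "list_diff (list_diff f) (x # xs) =
        (list_diff f xs + list_diff f xs) + list_diff (list_diff (\<lambda>ys. f (x # ys))) xs"
      by (simp add: list_diff_add add.assoc)
    then show ?case by (simp only: bit_add_self Cons.IH) simp
  qed simp
qed

lemma list_diff_map: "list_diff (\<lambda>ys. f (map s ys)) xs = list_diff f (map s xs)"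
  by (induction xs arbitrary: f) (simp_all)

lemma list_diff_supported:
  assumes "\<And>xs. length xs \<noteq> n \<Longrightarrow> f xs = 0" and "length xs \<noteq> Suc n"
  shows "list_diff f xs = 0"
  using assms
proof (induction xs arbitrary: f n)
  case (Cons x xs)
  have "list_diff (\<lambda>ys. f (x # ys)) xs = 0"
  proof (cases n)
    case 0
    then have "(\<lambda>ys. f (x # ys)) = (\<lambda>ys. 0)" using Cons.prems by simp
    then show ?thesis by (simp add: list_diff_zero)
  next
    case (Suc m)
    then show ?thesis using Cons.prems by (intro Cons.IH[of m]) auto
  qed
  then show ?case using Cons.prems by simp
qed simp

context
  fixes G :: "('g, 'b) monoid_scheme" (structure)
begin

text \<open>Extension by zero to lists of other lengths puts all degrees into one type. Entries
  range over the whole type, matching the later assumption \<open>carrier G = UNIV\<close>. The set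
  \<open>H\<close> need not be a subgroup, so generators can be adjoined one at a time.\<close>

definition inv_cochains :: "'g set \<Rightarrow> nat \<Rightarrow> ('g list \<Rightarrow> bit) set" where
  "inv_cochains H n = {f. (\<forall>xs. length xs \<noteq> Suc n \<longrightarrow> f xs = 0) \<and>
     (\<forall>h\<in>H. \<forall>xs. f (map ((\<otimes>) h) xs) = f xs)}"

definition translate_diff :: "'g \<Rightarrow> ('g list \<Rightarrow> bit) \<Rightarrow> ('g list \<Rightarrow> bit)" where
  "translate_diff t f = (\<lambda>xs. f (map ((\<otimes>) t) xs) - f xs)"

lemma cochain_complex_inv_cochains: "cochain_complex list_diff (inv_cochains H)"
proof
  show "add_subgroup (inv_cochains H n)" for n
    by (auto simp: add_subgroup_def inv_cochains_def)
  show "list_diff f \<in> inv_cochains H (Suc n)" if "f \<in> inv_cochains H n" for f n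
    using that list_diff_supported[of "Suc n" f] by (auto simp: inv_cochains_def simp flip: list_diff_map)
qed (simp_all add: list_diff_diff list_diff_list_diff)

lemma inv_cochains_insert:
  "inv_cochains (insert t H) n = {f \<in> inv_cochains H n. translate_diff t f = 0}"
  by (auto simp: inv_cochains_def translate_diff_def fun_eq_iff)

end

text \<open>Coning off at the first entry contracts the complex of all cochains.\<close>

lemma cohomology_order_no_invariance:
  fixes G :: "('g, 'b) monoid_scheme"
  shows "cohomology_order list_diff (inv_cochains G {}) n = (if n = 0 then 2 else 1)"
proof -
  interpret cochain_complex list_diff "inv_cochains G {}" by (rule cochain_complex_inv_cochains)
  define cone where "cone = (\<lambda>x (f :: 'g list \<Rightarrow> bit) xs. f (x # xs))"
  have cone: "list_diff (cone x f) xs = f xs" if "list_diff f = 0" for x f xs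
  proof -
    have "list_diff f (x # xs) = 0" using that by simp
    then have "f xs + list_diff (cone x f) xs = 0" by (simp add: cone_def)
    then show ?thesis by (simp add: bit_add_eq_0_iff)
  qed
  show ?thesis
  proof (cases n)
    case 0
    \<comment> \<open>Cocycles in degree 0 are the constant functions on one-entry lists; the entry
      \<open>undefined\<close> serves as base point.\<close>
    define c where "c = (\<lambda>b (xs :: 'g list). if length xs = 1 then b else (0 :: bit))"
    have "Z 0 = {c 0, c 1}"
    proof (intro equalityI subsetI)
      fix f assume f: "f \<in> Z 0"
      have "f xs = c (f [undefined]) xs" for xs
      proof (cases "length xs = 1")
        case True
        then obtain y where "xs = [y]" by (auto simp: length_Suc_conv)
        have "f [] = 0" using f by (simp add: cocycle_group_def inv_cochains_def)
        have "list_diff f [undefined, y] = 0" using f by (simp add: cocycle_group_def)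
        then have "f [y] + f [undefined] = 0" by (simp add: \<open>f [] = 0\<close>)
        then show ?thesis using \<open>xs = [y]\<close>
          by (simp add: c_def bit_add_eq_0_iff)
      qed (use f in \<open>simp add: cocycle_group_def inv_cochains_def c_def\<close>)
      then have "f = c (f [undefined])" by blast
      then show "f \<in> {c 0, c 1}" by (cases "f [undefined]") auto
    next
      fix f assume "f \<in> {c 0, c 1}"
      then obtain b where f: "f = c b" by blast
      have "list_diff (c b) xs = 0" for xs
      proof (cases "length xs = 2")
        case True
        then obtain x y where "xs = [x, y]" by (auto simp: length_Suc_conv numeral_2_eq_2)
        then show ?thesis by (simp add: c_def bit_add_self)
      next
        case False
        then show ?thesis by (intro list_diff_supported[of 1]) (simp_all add: c_def)
      qed
      then show "f \<in> Z 0" by (auto simp: f cocycle_group_def inv_cochains_def c_def fun_eq_iff)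
    qed
    moreover have "c 0 \<noteq> c 1" by (auto simp: c_def fun_eq_iff intro: exI[of _ "[undefined]"])
    ultimately show ?thesis
      by (simp add: 0 cohomology_order_def coboundary_group_def coset_index_zero)
  next
    case (Suc m)
    have "f \<in> B (Suc m)" if f: "f \<in> Z (Suc m)" for f
    proof -
      have "f = list_diff (cone undefined f)"
        using cone[of f undefined] f by (auto simp: cocycle_group_def)
      moreover have "cone undefined f \<in> inv_cochains G {} m"
        using f by (simp add: cocycle_group_def inv_cochains_def cone_def)
      ultimately show ?thesis by (simp add: coboundary_group_def)
    qed
    then have "Z (Suc m) = B (Suc m)" using B_subset_Z by blast
    then show ?thesis
      by (simp add: Suc cohomology_order_def coset_index_self[OF add_subgroup_B])
  qed
qed

section \<open>Adjoining one generator to the acting group\<close>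

context group
begin

text \<open>Invariance passes to products and inverses, so a generating set determines the same
  complex as the subgroup it generates.\<close>

lemma inv_cochains_generate:
  assumes "H \<subseteq> carrier G" and UNIV: "carrier G = UNIV"
  shows "inv_cochains G (generate G H) n = inv_cochains G H n"
proof (intro equalityI subsetI)
  fix f assume "f \<in> inv_cochains G (generate G H) n"
  then show "f \<in> inv_cochains G H n"
    using generate.incl[of _ H G] by (auto simp: inv_cochains_def)
next
  fix f assume f: "f \<in> inv_cochains G H n"
  have "f (map ((\<otimes>) h) xs) = f xs" if "h \<in> generate G H" for h xs
    using that
  proof (induction arbitrary: xs)
    case one
    then show ?case by (simp add: UNIV)
  next
    case (incl h)
    then show ?case using f by (simp add: inv_cochains_def)
  next
    case (inv h)
    then have "f (map ((\<otimes>) h) (map ((\<otimes>) (inv h)) xs)) = f (map ((\<otimes>) (inv h)) xs)"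
      using f by (simp only: inv_cochains_def mem_Collect_eq)
    moreover have "map ((\<otimes>) h) (map ((\<otimes>) (inv h)) xs) = xs"
      by (simp add: UNIV o_def flip: m_assoc)
    ultimately show ?case by simp
  next
    case (eng h1 h2)
    have "map ((\<otimes>) (h1 \<otimes> h2)) xs = map ((\<otimes>) h1) (map ((\<otimes>) h2) xs)"
      by (simp add: UNIV m_assoc)
    then show ?case using eng.IH by metis
  qed
  then show "f \<in> inv_cochains G (generate G H) n"
    using f by (simp add: inv_cochains_def)
qed

text \<open>Since t h x = (t h t^-1) t x, invariance of the translate under \<open>h\<close> follows
  from invariance of \<open>f\<close> under the conjugate of \<open>h\<close>.\<close>

lemma translate_inv_cochains:
  assumes UNIV: "carrier G = UNIV"
    and conj: "\<And>h. h \<in> H \<Longrightarrow> t \<otimes> h \<otimes> inv t \<in> generate G H"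
    and f: "f \<in> inv_cochains G H n"
  shows "(\<lambda>xs. f (map ((\<otimes>) t) xs)) \<in> inv_cochains G H n"
proof -
  have "f (map ((\<otimes>) t) (map ((\<otimes>) h) xs)) = f (map ((\<otimes>) t) xs)" if "h \<in> H" for h xs
  proof -
    have "map ((\<otimes>) t) (map ((\<otimes>) h) xs) = map ((\<otimes>) (t \<otimes> h \<otimes> inv t)) (map ((\<otimes>) t) xs)"
      by (simp add: UNIV m_assoc) (simp add: UNIV flip: m_assoc)
    moreover have "f \<in> inv_cochains G (generate G H) n"
      using f inv_cochains_generate[of H n] UNIV by simp
    ultimately show ?thesis
      using conj[OF that] by (simp only: inv_cochains_def mem_Collect_eq)
  qed
  then show ?thesis using f by (simp add: inv_cochains_def)
qed

text \<open>
  The solution of \<open>f (t x) - f x = e x\<close> with \<open>f = 0\<close> on tuples whose first entry has level \<open>0\<close>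
  sums \<open>e\<close> along the \<open>t\<close>-orbit.
\<close>

lemma translate_diff_surj:
  fixes level :: "'a \<Rightarrow> int"
  assumes UNIV: "carrier G = UNIV"
    and conj: "\<And>h. h \<in> H \<Longrightarrow> t \<otimes> h \<otimes> inv t \<in> generate G H"
      "\<And>h. h \<in> H \<Longrightarrow> inv t \<otimes> h \<otimes> t \<in> generate G H"
    and level: "\<And>x. level (t \<otimes> x) = level x + 1" "\<And>h x. h \<in> H \<Longrightarrow> level (h \<otimes> x) = level x"
    and e: "e \<in> inv_cochains G H n"
  shows "\<exists>f\<in>inv_cochains G H n. translate_diff G t f = e"
proof -
  define S where "S = map ((\<otimes>) t)"
  define S' where "S' = map ((\<otimes>) (inv t))"
  \<comment> \<open>For level \<open>k \<ge> 0\<close> the sum runs over the \<open>k\<close>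
    translates of the tuple by negative powers of \<open>t\<close>. For negative level it starts at
    the tuple itself and moves up to level 0; the minus sign this branch would carry disappears
    modulo two.\<close>
  define f where "f = (\<lambda>xs. if length xs \<noteq> Suc n then 0
    else let k = level (hd xs) in
      if k \<ge> 0 then \<Sum>j<nat k. e ((S' ^^ Suc j) xs) else \<Sum>j<nat (- k). e ((S ^^ j) xs))"
  have S'S: "S' (S xs) = xs" for xs
    by (simp add: S_def S'_def UNIV o_def flip: m_assoc)
  have eS: "(\<lambda>xs. e ((S ^^ j) xs)) \<in> inv_cochains G H n" for j
  proof (induction j)
    case (Suc j)
    have "(\<lambda>xs. e ((S ^^ Suc j) xs)) = (\<lambda>xs. e ((S ^^ j) (S xs)))" by (simp only: funpow_Suc_right o_apply)
    then show ?case
      using translate_inv_cochains[OF UNIV conj(1) Suc] by (simp add: S_def)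
  qed (simp add: e)
  have eS': "(\<lambda>xs. e ((S' ^^ j) xs)) \<in> inv_cochains G H n" for j
  proof (induction j)
    case (Suc j)
    have "(\<lambda>xs. e ((S' ^^ Suc j) xs)) = (\<lambda>xs. e ((S' ^^ j) (S' xs)))" by (simp only: funpow_Suc_right o_apply)
    then show ?case
      using translate_inv_cochains[OF UNIV _ Suc, of "inv t"] conj(2) by (simp add: S'_def UNIV)
  qed (simp add: e)
  have "f \<in> inv_cochains G H n"
  proof -
    \<comment> \<open>The level is unchanged by \<open>h\<close>, so both sides use the same sum,
      and each translate of \<open>e\<close> occurring in it is invariant.\<close>
    have "f (map ((\<otimes>) h) xs) = f xs" if h: "h \<in> H" for h xs
    proof (cases "length xs = Suc n")
      case True
      then have "hd (map ((\<otimes>) h) xs) = h \<otimes> hd xs" by (cases xs) auto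
      then show ?thesis
        using eS eS' level(2)[OF h] h True by (simp add: f_def inv_cochains_def Let_def del: funpow.simps)
    qed (simp add: f_def)
    then show ?thesis by (simp add: inv_cochains_def f_def)
  qed
  moreover have "f (S xs) - f xs = e xs" for xs
  proof (cases "length xs = Suc n")
    case True
    define k where "k = level (hd xs)"
    have k': "level (hd (S xs)) = k + 1" using True by (cases xs) (simp_all add: S_def level k_def)
    have len: "length (S xs) = Suc n" using True by (simp add: S_def)
    show ?thesis
    proof (cases "k \<ge> 0")
      case k: True
      have "f (S xs) = (\<Sum>j<Suc (nat k). e ((S' ^^ Suc j) (S xs)))"
        using k k' by (simp add: f_def len Let_def nat_add_distrib del: sum.lessThan_Suc funpow.simps)
      also have "\<dots> = (\<Sum>j<Suc (nat k). e ((S' ^^ j) xs))"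
        by (simp only: funpow_Suc_right o_apply S'S)
      also have "\<dots> = e xs + (\<Sum>j<nat k. e ((S' ^^ Suc j) xs))"
        by (simp only: sum.lessThan_Suc_shift) simp
      also have "(\<Sum>j<nat k. e ((S' ^^ Suc j) xs)) = f xs"
        using k True by (simp add: f_def Let_def flip: k_def)
      finally show ?thesis by (simp only: add_diff_cancel_right')
    next
      case k: False
      have "nat (- k) = Suc (nat (- (k + 1)))" using k by simp
      then have "f xs = (\<Sum>j<Suc (nat (- (k + 1))). e ((S ^^ j) xs))"
        using k True by (simp add: f_def Let_def flip: k_def)
      also have "\<dots> = e xs + (\<Sum>j<nat (- (k + 1)). e ((S ^^ Suc j) xs))"
        by (simp only: sum.lessThan_Suc_shift) simp
      also have "(\<Sum>j<nat (- (k + 1)). e ((S ^^ Suc j) xs)) = f (S xs)"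
        using k k' by (simp add: f_def len Let_def funpow_Suc_right del: funpow.simps)
      finally have "f xs = e xs + f (S xs)" .
      then have "f (S xs) - f xs = - e xs" by simp
      then show ?thesis by (simp add: uminus_bit_def)
    qed
  qed (use e in \<open>simp add: f_def S_def inv_cochains_def\<close>)
  ultimately show ?thesis by (auto simp: translate_diff_def S_def fun_eq_iff)
qed

text \<open>Here \<open>k n\<close> is the order of the \<open>t\<close>-invariants in the \<open>n\<close>-th cohomology.\<close>

lemma wang_orders:
  fixes level :: "'a \<Rightarrow> int"
  assumes UNIV: "carrier G = UNIV"
    and conj: "\<And>h. h \<in> H \<Longrightarrow> t \<otimes> h \<otimes> inv t \<in> generate G H"
      "\<And>h. h \<in> H \<Longrightarrow> inv t \<otimes> h \<otimes> t \<in> generate G H"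
    and level: "\<And>x. level (t \<otimes> x) = level x + 1" "\<And>h x. h \<in> H \<Longrightarrow> level (h \<otimes> x) = level x"
    and pos: "\<And>n. cohomology_order list_diff (inv_cochains G H) n > 0"
  obtains k where
    "cohomology_order list_diff (inv_cochains G (insert t H)) 0 = k 0"
    "\<And>n. cohomology_order list_diff (inv_cochains G (insert t H)) (Suc n) = k n * k (Suc n)"
    "\<And>n. cohomology_order list_diff (inv_cochains G H) n \<in> {1, 2} \<Longrightarrow>
      k n = cohomology_order list_diff (inv_cochains G H) n"
proof -
  let ?T = "translate_diff G t"
  let ?\<tau> = "\<lambda>f xs. f (map ((\<otimes>) t) xs) :: bit" and ?\<tau>' = "\<lambda>f xs. f (map ((\<otimes>) (inv t)) xs) :: bit"
  interpret cochain_complex list_diff "inv_cochains G H" by (rule cochain_complex_inv_cochains)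
  have \<tau>: "?\<tau> f \<in> inv_cochains G H n" if "f \<in> inv_cochains G H n" for f n
    using translate_inv_cochains[OF UNIV conj(1) that] by simp
  have \<tau>': "?\<tau>' f \<in> inv_cochains G H n" if "f \<in> inv_cochains G H n" for f n
    using translate_inv_cochains[OF UNIV _ that, of "inv t"] conj(2) by (simp add: UNIV)
  interpret surjective_endomorphism list_diff "inv_cochains G H" ?T
  proof
    show "?T (f - g) = ?T f - ?T g" for f g
      by (simp add: translate_diff_def fun_eq_iff)
    show "?T f \<in> inv_cochains G H n" if "f \<in> inv_cochains G H n" for f n
    proof -
      have "?T f = ?\<tau> f - f" by (simp add: translate_diff_def fun_eq_iff)
      then show ?thesis using add_subgroup_diff[OF add_subgroup_E \<tau>[OF that] that] by simp
    qed
    show "\<exists>f\<in>inv_cochains G H n. ?T f = e" if "e \<in> inv_cochains G H n" for e n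
      by (rule translate_diff_surj[where level = level]) (fact UNIV conj level that)+
    show "?T (list_diff f) = list_diff (?T f)" for f
    proof -
      have "?T f = ?\<tau> f - f" by (simp add: translate_diff_def fun_eq_iff)
      then have "list_diff (?T f) = list_diff (?\<tau> f) - list_diff f" by (simp only: list_diff_diff)
      then show ?thesis by (simp add: translate_diff_def list_diff_map fun_eq_iff)
    qed
  qed
  have F: "F = inv_cochains G (insert t H)"
    by (rule ext) (simp only: F_def inv_cochains_insert)
  show ?thesis
  proof (rule that[of "\<lambda>n. coset_index (K n) (B n)"])
    show "cohomology_order list_diff (inv_cochains G (insert t H)) 0 = coset_index (K 0) (B 0)"
      using cohomology_order_F_0 by (simp only: F)
    show "cohomology_order list_diff (inv_cochains G (insert t H)) (Suc n) =
        coset_index (K n) (B n) * coset_index (K (Suc n)) (B (Suc n))" for n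
      using cohomology_order_F_Suc[OF pos] by (simp only: F)
    show "coset_index (K n) (B n) = cohomology_order list_diff (inv_cochains G H) n"
      if "cohomology_order list_diff (inv_cochains G H) n \<in> {1, 2}" for n
    proof (rule K_index_small[OF that])
      fix z assume z: "z \<in> Z n" "?T z + z \<in> B n"
      \<comment> \<open>Adding 1 to t - 1 gives translation by \<open>t\<close>. Translation by the
        inverse of \<open>t\<close> undoes it and preserves coboundaries, which yields the
        injectivity needed for small cohomology groups.\<close>
      have "?T z + z = ?\<tau> z" by (simp add: translate_diff_def fun_eq_iff)
      with z have b: "?\<tau> z \<in> B n" by simp
      have z_eq: "z xs = ?\<tau> z (map ((\<otimes>) (inv t)) xs)" for xs
        by (simp add: UNIV o_def flip: m_assoc)
      show "z \<in> B n"
      proof (cases n)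
        case 0
        then have "?\<tau> z = 0" using b by (simp add: coboundary_group_def)
        then have "z xs = 0 xs" for xs
          by (subst z_eq) (simp only: fun_cong[OF \<open>?\<tau> z = 0\<close>] zero_fun_apply)
        then show ?thesis by (simp add: 0 coboundary_group_def fun_eq_iff)
      next
        case (Suc m)
        then obtain w where w: "w \<in> inv_cochains G H m" "?\<tau> z = list_diff w"
          using b by (auto simp: coboundary_group_def)
        have "z xs = list_diff (?\<tau>' w) xs" for xs
          unfolding list_diff_map by (rule trans[OF z_eq fun_cong[OF w(2)]])
        then have "z = list_diff (?\<tau>' w)" by blast
        then show ?thesis using \<tau>'[OF w(1)] by (simp add: Suc coboundary_group_def)
      qed
    qed
  qed
qed

end

section \<open>Comparison with the bar complex\<close>

text \<open>The isomorphism from the additive group of the field \<open>bit\<close> to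
  \<open>integer_mod_group 2\<close>, whose elements are the integers 0 and 1.\<close>

definition bit_int :: "bit \<Rightarrow> int" where
  "bit_int b = of_bool (b = 1)"

lemma bit_int_zero: "bit_int 0 = 0"
  by (simp add: bit_int_def)

lemma bit_int_closed: "bit_int b \<in> carrier (integer_mod_group 2)"
  by (simp add: bit_int_def carrier_integer_mod_group)

lemma bit_int_add: "bit_int (a + b) = bit_int a \<otimes>\<^bsub>integer_mod_group 2\<^esub> bit_int b"
  by (cases a; cases b) (simp_all add: bit_int_def)

lemma bit_int_inject: "bit_int a = bit_int b \<longleftrightarrow> a = b"
  by (cases a; cases b) (simp_all add: bit_int_def)

lemma bit_int_of_int: "x \<in> carrier (integer_mod_group 2) \<Longrightarrow> bit_int (of_int x) = x"
proof -
  assume "x \<in> carrier (integer_mod_group 2)"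
  then have "x = 0 \<or> x = 1" by (auto simp: carrier_integer_mod_group)
  then show ?thesis by (auto simp: bit_int_def)
qed

lemma bit_int_pow: "bit_int b [^]\<^bsub>integer_mod_group 2\<^esub> ((- 1) ^ i :: int) = bit_int b"
proof -
  have "(- 1) ^ i = (1 :: int) \<or> (- 1) ^ i = (- 1 :: int)" by (cases "even i") auto
  then show ?thesis by (auto simp: int_pow_integer_mod_group bit_int_def)
qed

lemma bit_int_sum:
  assumes "finite A"
  shows "finprod (integer_mod_group 2) (\<lambda>i. bit_int (f i)) A = bit_int (sum f A)"
proof -
  interpret M: comm_group "integer_mod_group 2" by simp
  show ?thesis
    using assms
  proof (induction A rule: finite_induct)
    case empty
    show ?case by (simp only: M.finprod_empty one_integer_mod_group sum.empty bit_int_zero)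
  next
    case (insert a A)
    then show ?case
      by (subst M.finprod_insert) (auto simp: bit_int_closed bit_int_add simp del: mult_integer_mod_group)
  qed
qed

text \<open>The list [x, x g1, x g1 g2, ...], by which inhomogeneous arguments become homogeneous
  ones.\<close>

fun partial_products :: "('g, 'b) monoid_scheme \<Rightarrow> 'g \<Rightarrow> 'g list \<Rightarrow> 'g list" where
  "partial_products G x [] = [x]"
| "partial_products G x (g # gs) = x # partial_products G (x \<otimes>\<^bsub>G\<^esub> g) gs"

text \<open>The usual passage from homogeneous to inhomogeneous cochains: an invariant function is
  determined by its values on lists that start at the identity.\<close>

definition bar_cochain ::
    "('g, 'b) monoid_scheme \<Rightarrow> nat \<Rightarrow> ('g list \<Rightarrow> bit) \<Rightarrow> 'g list \<Rightarrow> int" where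
  "bar_cochain G n F = (\<lambda>gs \<in> tuples G n. bit_int (F (partial_products G \<one>\<^bsub>G\<^esub> gs)))"

lemma length_partial_products [simp]: "length (partial_products G x gs) = Suc (length gs)"
  by (induction gs arbitrary: x) simp_all

lemma merge_at_Cons: "1 \<le> i \<Longrightarrow> merge_at G (Suc i) (g # gs) = g # merge_at G i gs"
  by (cases i) (simp_all add: merge_at_def)

lemma merge_at_one: "merge_at G (Suc 0) (g # h # gs) = (g \<otimes>\<^bsub>G\<^esub> h) # gs"
  by (simp add: merge_at_def)

lemma length_merge_at: "1 \<le> i \<Longrightarrow> i < length gs \<Longrightarrow> length (merge_at G i gs) = length gs - 1"
  by (simp add: merge_at_def)

context group
begin

lemma partial_products_translate:
  assumes "carrier G = UNIV"
  shows "partial_products G (g \<otimes> x) gs = map ((\<otimes>) g) (partial_products G x gs)"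
  by (induction gs arbitrary: x) (simp_all add: assms m_assoc)

text \<open>Deleting an inner entry of the partial products merges two neighbouring group elements,
  and deleting the last entry drops the last element. The face without the first entry is kept in
  raw form, since it no longer starts at \<open>x\<close>.\<close>

lemma list_diff_partial_products:
  assumes UNIV: "carrier G = UNIV" and "length gs = Suc n"
  shows "list_diff F (partial_products G x gs) =
    F (tl (partial_products G x gs)) + (\<Sum>i=1..n. F (partial_products G x (merge_at G i gs))) +
    F (partial_products G x (butlast gs))"
  using assms(2)
proof (induction gs arbitrary: n x F)
  case (Cons g gs)
  show ?case
  proof (cases n)
    case 0
    then show ?thesis using Cons.prems by simp
  next
    case (Suc m)
    then obtain h gs' where gs: "gs = h # gs'" using Cons.prems by (cases gs) auto
    let ?P = "partial_products G" and ?F = "\<lambda>ys. F (x # ys)"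
    have "list_diff F (?P x (g # gs)) = F (?P (x \<otimes> g) gs) +
       (?F (tl (?P (x \<otimes> g) gs)) + (\<Sum>i=1..m. ?F (?P (x \<otimes> g) (merge_at G i gs))) + ?F (?P (x \<otimes> g) (butlast gs)))"
      using Cons.IH[of m ?F "x \<otimes> g"] Cons.prems Suc by simp
    \<comment> \<open>The first face of the shorter list becomes the merge at position 1 of the
      longer one; the other merges shift by one.\<close>
    also have "?F (tl (?P (x \<otimes> g) gs)) = F (?P x (merge_at G 1 (g # gs)))"
      by (simp add: gs merge_at_one UNIV m_assoc)
    also have "(\<Sum>i=1..m. ?F (?P (x \<otimes> g) (merge_at G i gs))) =
        (\<Sum>i=1..m. F (?P x (merge_at G (Suc i) (g # gs))))"
      by (intro sum.cong) (simp_all add: merge_at_Cons)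
    also have "?F (?P (x \<otimes> g) (butlast gs)) = F (?P x (butlast (g # gs)))"
      by (simp add: gs)
    also have "F (?P x (merge_at G 1 (g # gs))) + (\<Sum>i=1..m. F (?P x (merge_at G (Suc i) (g # gs)))) =
        (\<Sum>i=1..n. F (?P x (merge_at G i (g # gs))))"
      by (simp add: Suc sum.atLeast_Suc_atMost sum.shift_bounds_cl_Suc_ivl del: sum.cl_ivl_Suc)
    finally show ?thesis by (simp add: add.assoc)
  qed
qed simp

text \<open>The faces agree one by one, and signs do not matter modulo two. Only the first face
  needs invariance of \<open>F\<close>: its list starts at \<open>g\<close> and has to be translated
  back to the identity.\<close>

lemma coboundary_bar_cochain:
  assumes UNIV: "carrier G = UNIV" and F: "F \<in> inv_cochains G (carrier G) n"
  shows "coboundary n G trivial_action (integer_mod_group 2) (bar_cochain G n F) =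
    bar_cochain G (Suc n) (list_diff F)"
  unfolding coboundary_def bar_cochain_def[of G "Suc n"]
proof (rule restrict_ext)
  fix gs assume "gs \<in> tuples G (Suc n)"
  then have len: "length gs = Suc n" by (simp add: tuples_def)
  then obtain g gs' where gs: "gs = g # gs'" by (cases gs) auto
  let ?M = "integer_mod_group 2"
  let ?v = "\<lambda>gs. bit_int (F (partial_products G \<one> gs))"
  have bar: "bar_cochain G n F hs = ?v hs" if "length hs = n" for hs
    using that by (simp add: bar_cochain_def tuples_def UNIV)
  have "partial_products G g gs' = map ((\<otimes>) g) (partial_products G \<one> gs')"
    using partial_products_translate[OF UNIV, of g \<one>] by (simp add: UNIV)
  then have "F (partial_products G \<one> gs') = F (partial_products G g gs')"
    using F UNIV by (simp only: inv_cochains_def mem_Collect_eq) simp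
  then have tl: "?v (tl gs) = bit_int (F (tl (partial_products G \<one> gs)))"
    by (simp add: gs UNIV)
  have "finprod ?M (\<lambda>i. bar_cochain G n F (merge_at G i gs) [^]\<^bsub>?M\<^esub> ((- 1) ^ i :: int)) {1..n} =
      finprod ?M (\<lambda>i. ?v (merge_at G i gs)) {1..n}"
  proof -
    interpret M: comm_group ?M by simp
    show ?thesis
      by (rule M.finprod_cong')
        (auto simp: bar length_merge_at len bit_int_pow bit_int_closed)
  qed
  then show "bar_cochain G n F (tl gs) \<otimes>\<^bsub>?M\<^esub>
      finprod ?M (\<lambda>i. bar_cochain G n F (merge_at G i gs) [^]\<^bsub>?M\<^esub> ((- 1) ^ i :: int)) {1..n} \<otimes>\<^bsub>?M\<^esub>
      bar_cochain G n F (butlast gs) [^]\<^bsub>?M\<^esub> ((- 1) ^ Suc n :: int) =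
      bit_int (list_diff F (partial_products G \<one> gs))"
    by (simp only: bar length_tl length_butlast len diff_Suc_1 tl bit_int_sum finite_atLeastAtMost
        bit_int_pow list_diff_partial_products[OF UNIV len] bit_int_add)
qed

lemma bar_cochain_add:
  "bar_cochain G n (F + F') =
    bar_cochain G n F \<otimes>\<^bsub>cochains n G (integer_mod_group 2)\<^esub> bar_cochain G n F'"
  by (auto simp: bar_cochain_def cochains_def bit_int_add fun_eq_iff)

lemma bar_cochain_zero: "bar_cochain G n 0 = \<one>\<^bsub>cochains n G (integer_mod_group 2)\<^esub>"
  by (auto simp: bar_cochain_def cochains_def bit_int_zero fun_eq_iff)

lemma bar_cochain_closed: "bar_cochain G n F \<in> carrier (cochains n G (integer_mod_group 2))"
  by (auto simp: bar_cochain_def cochains_def bit_int_closed)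

text \<open>Every nonempty list is a left translate of a list of partial products starting at the
  identity, so invariance recovers all values of the cochain.\<close>

lemma inj_on_bar_cochain:
  assumes UNIV: "carrier G = UNIV"
  shows "inj_on (bar_cochain G n) (inv_cochains G (carrier G) n)"
proof (rule inj_onI)
  fix F F' assume F: "F \<in> inv_cochains G (carrier G) n" "F' \<in> inv_cochains G (carrier G) n"
    and eq: "bar_cochain G n F = bar_cochain G n F'"
  have surj: "\<exists>gs. length gs = length xs \<and> partial_products G x gs = x # xs" for x xs
  proof (induction xs arbitrary: x)
    case (Cons y ys)
    obtain gs where "length gs = length ys" "partial_products G y gs = y # ys" using Cons by blast
    then show ?case
      by (intro exI[of _ "(inv x \<otimes> y) # gs"]) (simp add: UNIV flip: m_assoc)
  qed simp
  have "F xs = F' xs" for xs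
  proof (cases "length xs = Suc n")
    case True
    then obtain x ys where xs: "xs = x # ys" "length ys = n" by (cases xs) auto
    obtain gs where gs: "length gs = n" "partial_products G x gs = xs" using surj[of ys x] xs by auto
    have "partial_products G x gs = map ((\<otimes>) x) (partial_products G \<one> gs)"
      using partial_products_translate[OF UNIV, of x \<one>] by (simp add: UNIV)
    then have H: "H xs = H (partial_products G \<one> gs)" if "H \<in> inv_cochains G (carrier G) n" for H
      using that gs(2) by (simp add: inv_cochains_def UNIV)
    have "F (partial_products G \<one> gs) = F' (partial_products G \<one> gs)"
      using fun_cong[OF eq, of gs] gs(1) by (simp add: bar_cochain_def tuples_def UNIV bit_int_inject)
    then show ?thesis using H[OF F(1)] H[OF F(2)] by simp
  qed (use F in \<open>simp add: inv_cochains_def\<close>)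
  then show "F = F'" by blast
qed

text \<open>Recovers the group elements from their partial products, independently of the starting
  point.\<close>

fun quotients :: "'a list \<Rightarrow> 'a list" where
  "quotients (x # y # ys) = (inv x \<otimes> y) # quotients (y # ys)"
| "quotients _ = []"

lemma quotients_translate:
  assumes UNIV: "carrier G = UNIV"
  shows "quotients (map ((\<otimes>) g) xs) = quotients xs"
proof (induction xs rule: quotients.induct)
  case (1 x y ys)
  have "inv (g \<otimes> x) \<otimes> (g \<otimes> y) = inv x \<otimes> (inv g \<otimes> g) \<otimes> y"
    by (simp only: UNIV inv_mult_group UNIV_I m_assoc)
  also have "\<dots> = inv x \<otimes> y" by (simp add: UNIV)
  finally show ?case using 1 by simp
qed simp_all

lemma quotients_partial_products:
  assumes UNIV: "carrier G = UNIV"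
  shows "quotients (partial_products G x gs) = gs"
proof (induction gs arbitrary: x)
  case (Cons g gs)
  obtain ys where ys: "partial_products G (x \<otimes> g) gs = (x \<otimes> g) # ys"
    by (cases gs) simp_all
  have "inv x \<otimes> (x \<otimes> g) = g" by (simp add: UNIV flip: m_assoc)
  then show ?case using Cons[of "x \<otimes> g"] by (simp add: ys)
qed simp

text \<open>The preimage is \<open>f\<close> composed with \<open>quotients\<close>, which is
  invariant because quotients of consecutive entries do not change under left translation.\<close>

lemma bar_cochain_surj:
  assumes UNIV: "carrier G = UNIV" and f: "f \<in> carrier (cochains n G (integer_mod_group 2))"
  shows "\<exists>F\<in>inv_cochains G (carrier G) n. bar_cochain G n F = f"
proof
  let ?F = "\<lambda>xs. if length xs = Suc n then of_int (f (quotients xs)) else (0 :: bit)"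
  show "?F \<in> inv_cochains G (carrier G) n"
    by (simp add: inv_cochains_def quotients_translate[OF UNIV])
  have f_mem: "f \<in> extensional (tuples G n)" "\<And>gs. gs \<in> tuples G n \<Longrightarrow> f gs \<in> carrier (integer_mod_group 2)"
    using f by (auto simp: cochains_def PiE_iff)
  show "bar_cochain G n ?F = f"
  proof
    fix gs
    show "bar_cochain G n ?F gs = f gs"
    proof (cases "gs \<in> tuples G n")
      case True
      then have "length gs = n" by (simp add: tuples_def)
      then show ?thesis
        using True f_mem(2)[OF True]
        by (simp add: bar_cochain_def quotients_partial_products[OF UNIV] bit_int_of_int)
    next
      case False
      then show ?thesis using f_mem(1) by (simp add: bar_cochain_def extensional_def)
    qed
  qed
qed

text \<open>\<open>bar_cochain\<close> is an isomorphism of complexes, so it matches cocycles,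
  coboundaries and hence cosets. Exponent two is inherited from the identity F + F = 0 on
  cochains.\<close>

lemma group_cohomology_order:
  fixes n :: nat
  assumes UNIV: "carrier G = UNIV"
  defines "Hn \<equiv> group_cohomology n G trivial_action (integer_mod_group 2)"
  shows "comm_group Hn"
    and "\<And>c. c \<in> carrier Hn \<Longrightarrow> c \<otimes>\<^bsub>Hn\<^esub> c = \<one>\<^bsub>Hn\<^esub>"
    and "order Hn = cohomology_order list_diff (inv_cochains G (carrier G)) n"
proof -
  let ?M = "integer_mod_group 2" and ?E = "inv_cochains G (carrier G)"
  interpret cochain_complex list_diff ?E by (rule cochain_complex_inv_cochains)
  let ?C = "cochains n G ?M" and ?\<beta> = "bar_cochain G n"
  interpret C: comm_group ?C
    unfolding cochains_def
    by (rule group.group_comm_groupI) (auto intro!: product_group simp: add.commute fun_eq_iff)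
  note inj = inj_on_bar_cochain[OF UNIV]
  have ZE: "Z n \<subseteq> ?E n" by (auto simp: cocycle_group_def)
  have cocycles: "cocycles n G trivial_action ?M = ?\<beta> ` Z n"
  proof (intro equalityI subsetI)
    fix f assume f: "f \<in> cocycles n G trivial_action ?M"
    then have fC: "f \<in> carrier ?C" by (simp add: cocycles_def kernel_def)
    obtain F where F: "F \<in> ?E n" "?\<beta> F = f" using bar_cochain_surj[OF UNIV fC] by blast
    then have "bar_cochain G (Suc n) (list_diff F) = bar_cochain G (Suc n) 0"
      using f coboundary_bar_cochain[OF UNIV F(1)]
      by (simp add: cocycles_def kernel_def bar_cochain_zero)
    \<comment> \<open>Injectivity is applied here one degree higher, to \<open>list_diff F\<close>
      and 0.\<close>
    then have "list_diff F = 0"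
      using inj_onD[OF inj _ d_closed[OF F(1)] add_subgroup_zero[OF add_subgroup_E]] by blast
    then show "f \<in> ?\<beta> ` Z n" using F by (auto simp: cocycle_group_def)
  next
    fix f assume "f \<in> ?\<beta> ` Z n"
    then obtain F where F: "F \<in> ?E n" "list_diff F = 0" "f = ?\<beta> F" by (auto simp: cocycle_group_def)
    then show "f \<in> cocycles n G trivial_action ?M"
      using coboundary_bar_cochain[OF UNIV F(1)]
      by (simp add: cocycles_def kernel_def bar_cochain_zero bar_cochain_closed)
  qed
  have coboundaries: "coboundaries n G trivial_action ?M = ?\<beta> ` B n"
  proof (cases n)
    case 0
    then show ?thesis by (simp add: coboundary_group_def bar_cochain_zero)
  next
    case (Suc m)
    have "carrier (cochains m G ?M) = bar_cochain G m ` ?E m"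
      using bar_cochain_surj[OF UNIV] bar_cochain_closed by blast
    then have "coboundaries n G trivial_action ?M =
        (\<lambda>F. coboundary m G trivial_action ?M (bar_cochain G m F)) ` ?E m"
      by (simp add: Suc image_image)
    also have "\<dots> = (\<lambda>F. bar_cochain G (Suc m) (list_diff F)) ` ?E m"
      by (intro image_cong) (simp_all add: coboundary_bar_cochain[OF UNIV])
    finally show ?thesis by (simp add: Suc coboundary_group_def image_image)
  qed
  have self: "F + F = 0" for F :: "'a list \<Rightarrow> bit"
    by (simp add: fun_eq_iff bit_add_self)
  have self_\<beta>: "?\<beta> F \<otimes>\<^bsub>?C\<^esub> ?\<beta> F = \<one>\<^bsub>?C\<^esub>" for F
    by (simp only: self bar_cochain_zero flip: bar_cochain_add)
  have subgroup_\<beta>: "subgroup (?\<beta> ` A) ?C" if A: "add_subgroup A" for A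
  proof (rule C.subgroupI)
    show "?\<beta> ` A \<subseteq> carrier ?C" using bar_cochain_closed by blast
    show "?\<beta> ` A \<noteq> {}" using add_subgroup_zero[OF A] by blast
    show "inv\<^bsub>?C\<^esub> f \<in> ?\<beta> ` A" if f: "f \<in> ?\<beta> ` A" for f
    proof -
      obtain F where F: "F \<in> A" "f = ?\<beta> F" using f by blast
      then have "inv\<^bsub>?C\<^esub> f = f"
        by (intro C.inv_equality) (simp_all add: self_\<beta> bar_cochain_closed)
      then show ?thesis using f by simp
    qed
    show "f \<otimes>\<^bsub>?C\<^esub> g \<in> ?\<beta> ` A" if fg: "f \<in> ?\<beta> ` A" "g \<in> ?\<beta> ` A" for f g
    proof -
      obtain F F' where "F \<in> A" "F' \<in> A" "f = ?\<beta> F" "g = ?\<beta> F'" using fg by blast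
      then show ?thesis
        using add_subgroup_add[OF A] by (auto simp flip: bar_cochain_add)
    qed
  qed
  let ?K = "?C\<lparr>carrier := ?\<beta> ` Z n\<rparr>" and ?N = "?\<beta> ` B n"
  have Hn: "Hn = ?K Mod ?N"
    by (simp add: Hn_def group_cohomology_def cocycles coboundaries)
  have K: "comm_group ?K"
    by (rule group.group_comm_groupI[OF C.subgroup_imp_group[OF subgroup_\<beta>[OF add_subgroup_Z]]])
      (auto simp: C.m_comm bar_cochain_closed)
  then interpret K: comm_group ?K .
  have N: "subgroup ?N ?K"
    using C.subgroup_incl[OF subgroup_\<beta>[OF add_subgroup_B] subgroup_\<beta>[OF add_subgroup_Z]]
      B_subset_Z by blast
  then interpret N: normal ?N ?K by (rule K.subgroup_imp_normal)
  show "comm_group Hn"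
    unfolding Hn by (rule K.abelian_FactGroup[OF N])
  show "c \<otimes>\<^bsub>Hn\<^esub> c = \<one>\<^bsub>Hn\<^esub>" if c: "c \<in> carrier Hn" for c
  proof -
    obtain F where F: "F \<in> Z n" "c = ?N #>\<^bsub>?K\<^esub> ?\<beta> F"
      using c by (auto simp: Hn carrier_FactGroup)
    then have "c \<otimes>\<^bsub>Hn\<^esub> c = ?N #>\<^bsub>?K\<^esub> (?\<beta> F \<otimes>\<^bsub>?K\<^esub> ?\<beta> F)"
      by (simp only: Hn mult_FactGroup) (rule N.rcos_sum; simp)
    also have "\<dots> = ?N #>\<^bsub>?K\<^esub> \<one>\<^bsub>?K\<^esub>" by (simp add: self_\<beta>)
    also have "\<dots> = ?N" by (rule K.coset_mult_one) (rule N.subset)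
    finally show ?thesis by (simp add: Hn)
  qed
  have coset: "?N #>\<^bsub>?K\<^esub> ?\<beta> F = ?\<beta> ` ((+) F ` B n)" for F
    by (auto simp: r_coset_def image_image image_iff add.commute simp flip: bar_cochain_add)
  have "card ((\<lambda>F. (+) F ` B n) ` Z n) = card ((\<lambda>f. ?N #>\<^bsub>?K\<^esub> f) ` (?\<beta> ` Z n))"
  proof (rule card_image_transfer[where f = ?\<beta>])
    fix F F' assume F: "F \<in> Z n" "F' \<in> Z n"
    have sub: "(+) F ` B n \<subseteq> ?E n" if "F \<in> Z n" for F
      using that B_subset_Z ZE add_subgroup_add[OF add_subgroup_E] by blast
    show "(+) F ` B n = (+) F' ` B n \<longleftrightarrow> ?N #>\<^bsub>?K\<^esub> ?\<beta> F = ?N #>\<^bsub>?K\<^esub> ?\<beta> F'"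
      unfolding coset using inj_on_image_eq_iff[OF inj sub[OF F(1)] sub[OF F(2)]] by simp
  qed auto
  then show "order Hn = cohomology_order list_diff ?E n"
    by (simp add: Hn order_def carrier_FactGroup cohomology_order_def coset_index_def)
qed

end

section \<open>Finite groups of exponent two\<close>

lemma group_Z2_power: "group (Z2_power r)"
  by simp

lemma card_Z2_power: "card (carrier (Z2_power r)) = 2 ^ r"
  by (simp add: card_PiE carrier_integer_mod_group)

text \<open>The new coordinate is sent to \<open>x\<close>. Injectivity survives because a kernel
  element with nonzero new coordinate would place \<open>x\<close> in the image of \<phi>.\<close>

lemma (in comm_group) Z2_power_mon_extend:
  assumes exp: "\<And>x. x \<in> carrier G \<Longrightarrow> x \<otimes> x = \<one>"
    and \<phi>: "\<phi> \<in> hom (Z2_power s) G" "inj_on \<phi> (carrier (Z2_power s))"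
    and x: "x \<in> carrier G" "x \<notin> \<phi> ` carrier (Z2_power s)"
  shows "\<exists>\<psi>. \<psi> \<in> hom (Z2_power (Suc s)) G \<and> inj_on \<psi> (carrier (Z2_power (Suc s)))"
proof -
  define e where "e = (\<lambda>k :: int. if k = 0 then \<one> else x)"
  define \<psi> where "\<psi> = (\<lambda>u. \<phi> (restrict u {..<s}) \<otimes> e (u s))"
  have e_closed: "e k \<in> carrier G" for k by (simp add: e_def x)
  have e_add: "e ((k + l) mod 2) = e k \<otimes> e l" if "k \<in> {0..<2}" "l \<in> {0..<2}" for k l
  proof -
    have "k = 0 \<or> k = 1" "l = 0 \<or> l = 1" using that by auto
    then show ?thesis by (auto simp: e_def x exp)
  qed
  have res: "restrict u {..<s} \<in> carrier (Z2_power s)" if "u \<in> carrier (Z2_power (Suc s))" for u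
    using that by (auto simp: PiE_iff)
  have last: "u s \<in> {0..<2}" if "u \<in> carrier (Z2_power (Suc s))" for u
    using that by (auto simp: PiE_iff carrier_integer_mod_group)
  have \<phi>_closed: "\<phi> u \<in> carrier G" if "u \<in> carrier (Z2_power s)" for u
    using \<phi>(1) that by (rule hom_in_carrier)
  have hom: "\<psi> \<in> hom (Z2_power (Suc s)) G"
  proof (rule homI)
    fix u v assume u: "u \<in> carrier (Z2_power (Suc s))" and v: "v \<in> carrier (Z2_power (Suc s))"
    have "restrict (u \<otimes>\<^bsub>Z2_power (Suc s)\<^esub> v) {..<s} =
        restrict u {..<s} \<otimes>\<^bsub>Z2_power s\<^esub> restrict v {..<s}"
      by (auto simp: fun_eq_iff)
    then have 1: "\<phi> (restrict (u \<otimes>\<^bsub>Z2_power (Suc s)\<^esub> v) {..<s}) =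
        \<phi> (restrict u {..<s}) \<otimes> \<phi> (restrict v {..<s})"
      using hom_mult[OF \<phi>(1) res[OF u] res[OF v]] by (simp only:)
    have 2: "e ((u \<otimes>\<^bsub>Z2_power (Suc s)\<^esub> v) s) = e (u s) \<otimes> e (v s)"
      using e_add[OF last[OF u] last[OF v]] by simp
    show "\<psi> (u \<otimes>\<^bsub>Z2_power (Suc s)\<^esub> v) = \<psi> u \<otimes> \<psi> v"
      unfolding \<psi>_def 1 2 using \<phi>_closed[OF res[OF u]] \<phi>_closed[OF res[OF v]] e_closed
      by (simp add: m_ac)
  next
    fix u assume "u \<in> carrier (Z2_power (Suc s))"
    then show "\<psi> u \<in> carrier G" using \<phi>_closed[OF res] e_closed by (simp add: \<psi>_def)
  qed
  have \<phi>_one: "v = \<one>\<^bsub>Z2_power s\<^esub>" if "v \<in> carrier (Z2_power s)" "\<phi> v = \<one>" for v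
    using \<phi>(2) that inj_on_one_iff'[OF \<phi>(1) group_Z2_power is_group] by blast
  have "u = \<one>\<^bsub>Z2_power (Suc s)\<^esub>" if u: "u \<in> carrier (Z2_power (Suc s))" and one: "\<psi> u = \<one>" for u
  proof -
    let ?v = "restrict u {..<s}"
    have v: "\<phi> ?v \<in> carrier G" using \<phi>_closed[OF res[OF u]] .
    have us: "u s = 0"
    proof (rule ccontr)
      assume "u s \<noteq> 0"
      \<comment> \<open>Both sides are the identity, the right one by exponent two.\<close>
      then have "\<phi> ?v \<otimes> x = \<phi> ?v \<otimes> \<phi> ?v" using one exp[OF v] by (simp add: \<psi>_def e_def)
      then have "x = \<phi> ?v" using v x(1) by simp
      then show False using x(2) res[OF u] by blast
    qed
    then have v: "?v = \<one>\<^bsub>Z2_power s\<^esub>"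
      using one \<open>\<phi> ?v \<in> carrier G\<close> res[OF u] by (intro \<phi>_one) (simp_all add: \<psi>_def e_def)
    have v0: "u i = 0" if "i < s" for i
      using fun_cong[OF v, of i] that by simp
    show ?thesis
    proof
      fix i
      show "u i = \<one>\<^bsub>Z2_power (Suc s)\<^esub> i"
        using v0[of i] us u by (cases "i < s"; cases "i = s") (auto simp: PiE_iff extensional_def)
    qed
  qed
  then have "inj_on \<psi> (carrier (Z2_power (Suc s)))"
    using inj_on_one_iff'[OF hom group_Z2_power is_group] by blast
  with hom show ?thesis by blast
qed

text \<open>As long as s < r, an embedded copy of \<open>Z2_power s\<close> is too small to fill
  \<open>G\<close>, so a missed element allows another extension. At s = r equality of orders makes
  the embedding onto.\<close>

lemma (in comm_group) exponent_two_iso_Z2_power: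
  assumes exp: "\<And>x. x \<in> carrier G \<Longrightarrow> x \<otimes> x = \<one>"
    and order: "order G = 2 ^ r"
  shows "G \<cong> Z2_power r"
proof -
  have fin: "finite (carrier G)" using order order_gt_0_iff_finite by simp
  have "\<exists>\<phi>. \<phi> \<in> hom (Z2_power s) G \<and> inj_on \<phi> (carrier (Z2_power s))" if "s \<le> r" for s
    using that
  proof (induction s)
    case 0
    have "(\<lambda>_. \<one>) \<in> hom (Z2_power 0) G" by (simp add: hom_def)
    moreover have "inj_on (\<lambda>_. \<one>) (carrier (Z2_power 0))" by (simp add: inj_on_def)
    ultimately show ?case by blast
  next
    case (Suc s)
    then obtain \<phi> where \<phi>: "\<phi> \<in> hom (Z2_power s) G" "inj_on \<phi> (carrier (Z2_power s))" by auto
    have "card (\<phi> ` carrier (Z2_power s)) = 2 ^ s"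
      using card_image[OF \<phi>(2)] card_Z2_power by (simp only:)
    also have "(2 :: nat) ^ s < card (carrier G)" using Suc.prems order by (simp add: order_def)
    finally have "\<phi> ` carrier (Z2_power s) \<noteq> carrier G" by auto
    moreover have "\<phi> ` carrier (Z2_power s) \<subseteq> carrier G" using hom_in_carrier[OF \<phi>(1)] by blast
    ultimately obtain x where "x \<in> carrier G" "x \<notin> \<phi> ` carrier (Z2_power s)" by blast
    then show ?case using Z2_power_mon_extend[OF exp \<phi>] by blast
  qed
  then obtain \<phi> where \<phi>: "\<phi> \<in> hom (Z2_power r) G" "inj_on \<phi> (carrier (Z2_power r))" by blast
  have "card (\<phi> ` carrier (Z2_power r)) = card (carrier G)"
    using card_image[OF \<phi>(2)] card_Z2_power order by (simp only: order_def)
  moreover have "\<phi> ` carrier (Z2_power r) \<subseteq> carrier G" using hom_in_carrier[OF \<phi>(1)] by blast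
  ultimately have "\<phi> ` carrier (Z2_power r) = carrier G" using card_subset_eq[OF fin] by blast
  with \<phi> have "\<phi> \<in> iso (Z2_power r) G" by (intro iso_iff[THEN iffD2] conjI)
  then show ?thesis by (intro group.iso_sym[OF group_Z2_power] is_isoI)
qed

lemma Z2_iso_Z2_power_1: "integer_mod_group 2 \<cong> Z2_power 1"
proof (rule comm_group.exponent_two_iso_Z2_power)
  show "comm_group (integer_mod_group 2)" by (rule abelian_integer_mod_group)
  show "order (integer_mod_group 2) = 2 ^ 1" by (simp add: order_def carrier_integer_mod_group)
  show "x \<otimes>\<^bsub>integer_mod_group 2\<^esub> x = \<one>\<^bsub>integer_mod_group 2\<^esub>" for x
    by simp
qed

section \<open>Semidirect products and torus bundle groups\<close>

lemma semidirect_product_group: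
  assumes "group N" "group H" and \<phi>: "\<phi> \<in> hom H (AutoGroup N)"
  shows "group (semidirect_product N H \<phi>)"
proof -
  interpret N: group N by fact
  interpret H: group H by fact
  have auto: "\<phi> k \<in> auto N" if "k \<in> carrier H" for k
    using hom_in_carrier[OF \<phi> that] by (simp add: AutoGroup_def)
  have closed: "\<phi> k x \<in> carrier N" if "k \<in> carrier H" "x \<in> carrier N" for k x
    using auto[OF that(1)] that(2) by (auto simp: auto_def hom_def)
  have mult: "\<phi> k (x \<otimes>\<^bsub>N\<^esub> y) = \<phi> k x \<otimes>\<^bsub>N\<^esub> \<phi> k y"
    if "k \<in> carrier H" "x \<in> carrier N" "y \<in> carrier N" for k x y
    using auto[OF that(1)] that by (auto simp: auto_def hom_def)
  have one: "\<phi> \<one>\<^bsub>H\<^esub> x = x" if "x \<in> carrier N" for x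
    using that hom_one[OF \<phi> \<open>group H\<close> N.AutoGroup] by (simp add: AutoGroup_def BijGroup_def)
  have comp: "\<phi> (k \<otimes>\<^bsub>H\<^esub> l) x = \<phi> k (\<phi> l x)"
    if "k \<in> carrier H" "l \<in> carrier H" "x \<in> carrier N" for k l x
    using hom_mult[OF \<phi> that(1,2)] auto[OF that(1)] auto[OF that(2)] that(3)
    by (simp add: AutoGroup_def BijGroup_def auto_def compose_def)
  show ?thesis
  proof (rule groupI)
    fix x y z
    assume "x \<in> carrier (semidirect_product N H \<phi>)" "y \<in> carrier (semidirect_product N H \<phi>)"
      "z \<in> carrier (semidirect_product N H \<phi>)"
    then show "x \<otimes>\<^bsub>semidirect_product N H \<phi>\<^esub> y \<otimes>\<^bsub>semidirect_product N H \<phi>\<^esub> z =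
        x \<otimes>\<^bsub>semidirect_product N H \<phi>\<^esub> (y \<otimes>\<^bsub>semidirect_product N H \<phi>\<^esub> z)"
      by (auto simp: semidirect_product_def mult comp closed N.m_assoc H.m_assoc)
  next
    fix x assume "x \<in> carrier (semidirect_product N H \<phi>)"
    then obtain g k where x: "x = (g, k)" "g \<in> carrier N" "k \<in> carrier H"
      by (auto simp: semidirect_product_def)
    let ?y = "(\<phi> (inv\<^bsub>H\<^esub> k) (inv\<^bsub>N\<^esub> g), inv\<^bsub>H\<^esub> k)"
    have "\<phi> (inv\<^bsub>H\<^esub> k) (inv\<^bsub>N\<^esub> g) \<otimes>\<^bsub>N\<^esub> \<phi> (inv\<^bsub>H\<^esub> k) g = \<one>\<^bsub>N\<^esub>"
    proof -
      \<comment> \<open>The image of the identity is idempotent, hence the identity.\<close>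
      have "\<phi> (inv\<^bsub>H\<^esub> k) \<one>\<^bsub>N\<^esub> \<otimes>\<^bsub>N\<^esub> \<phi> (inv\<^bsub>H\<^esub> k) \<one>\<^bsub>N\<^esub> = \<phi> (inv\<^bsub>H\<^esub> k) \<one>\<^bsub>N\<^esub>"
        using x by (simp flip: mult)
      then have "\<phi> (inv\<^bsub>H\<^esub> k) \<one>\<^bsub>N\<^esub> = \<one>\<^bsub>N\<^esub>" using x closed by simp
      then show ?thesis using x by (simp flip: mult)
    qed
    then show "\<exists>y\<in>carrier (semidirect_product N H \<phi>).
        y \<otimes>\<^bsub>semidirect_product N H \<phi>\<^esub> x = \<one>\<^bsub>semidirect_product N H \<phi>\<^esub>"
      using x closed by (intro bexI[of _ ?y]) (auto simp: semidirect_product_def)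
  qed (auto simp: semidirect_product_def closed one)
qed

lemma matrix_action_apply:
  "matrix_action A (m, n) = (A $ 1 $ 1 * m + A $ 1 $ 2 * n, A $ 2 $ 1 * m + A $ 2 $ 2 * n)"
  by (simp add: matrix_action_def matrix_vector_mult_def sum_2)

lemma matrix_action_mult: "matrix_action (A ** B) v = matrix_action A (matrix_action B v)"
  by (cases v) (simp add: matrix_action_apply matrix_matrix_mult_def sum_2 algebra_simps)

lemma matrix_action_mat_1: "matrix_action (mat 1) v = v"
  by (cases v) (simp add: matrix_action_apply mat_def)

lemma matrix_action_add: "matrix_action A (v + w) = matrix_action A v + matrix_action A w"
  by (cases v; cases w) (simp add: matrix_action_apply algebra_simps)

lemma mult_Z_plus_Z: "v \<otimes>\<^bsub>Z_plus_Z\<^esub> w = v + w"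
  by (cases v; cases w) simp

text \<open>Invertibility is meant over the integers, so the inverse matrix also acts on pairs of
  integers and inverts the action.\<close>

lemma matrix_action_AutoGroup:
  assumes "invertible A"
  shows "matrix_action A \<in> carrier (AutoGroup Z_plus_Z)"
proof -
  obtain B where B: "A ** B = mat 1" "B ** A = mat 1"
    using assms by (auto simp: invertible_def)
  have "bij (matrix_action A)"
    by (rule bij_betw_byWitness[where f' = "matrix_action B"])
      (simp_all add: matrix_action_mat_1 B flip: matrix_action_mult)
  moreover have "matrix_action A \<in> hom Z_plus_Z Z_plus_Z"
    by (rule homI) (simp_all only: mult_Z_plus_Z matrix_action_add, simp)
  ultimately show ?thesis
    by (simp add: AutoGroup_def auto_def Bij_def)
qed

lemma int_induct_both:
  assumes "P (0 :: int)" "\<And>k. P k \<Longrightarrow> P (k + 1)" "\<And>k. P k \<Longrightarrow> P (k - 1)"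
  shows "P k"
  by (induction k rule: int_induct[where k = 0]) (use assms in auto)

section \<open>The torus bundle group and its generators\<close>

locale torus_bundle =
  fixes \<theta> :: "int^2^2"
  assumes invertible_\<theta>: "invertible \<theta>"
begin

abbreviation "T \<equiv> torus_bundle_group \<theta>"

definition \<rho> :: "int \<Rightarrow> int \<times> int \<Rightarrow> int \<times> int" where
  "\<rho> k = matrix_action \<theta> [^]\<^bsub>AutoGroup Z_plus_Z\<^esub> k"

lemma group_Z_plus_Z: "group Z_plus_Z"
  by (simp add: DirProd_group)

lemma \<rho>_hom: "\<rho> \<in> hom integer_group (AutoGroup Z_plus_Z)"
proof -
  interpret A: group "AutoGroup Z_plus_Z" by (rule group.AutoGroup[OF group_Z_plus_Z])
  have "\<rho> = ([^]\<^bsub>AutoGroup Z_plus_Z\<^esub>) (matrix_action \<theta>)"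
    by (simp add: \<rho>_def fun_eq_iff)
  then show ?thesis
    using A.int_pow_is_hom[OF matrix_action_AutoGroup[OF invertible_\<theta>]]
    by (simp only: integer_group_def)
qed

lemma T_eq: "T = semidirect_product Z_plus_Z integer_group \<rho>"
  unfolding torus_bundle_group_def \<rho>_def ..

sublocale group T
  unfolding T_eq by (rule semidirect_product_group[OF group_Z_plus_Z group_integer_group \<rho>_hom])

lemma carrier_T: "carrier T = UNIV"
  by (simp add: T_eq semidirect_product_def)

lemma mult_T: "(v, k) \<otimes>\<^bsub>T\<^esub> (w, l) = (v + \<rho> k w, k + l)"
  by (simp add: T_eq semidirect_product_def mult_Z_plus_Z)

lemma one_T: "\<one>\<^bsub>T\<^esub> = (0, 0)"
  by (simp add: T_eq semidirect_product_def zero_prod_def)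

lemma \<rho>_auto: "\<rho> k \<in> auto Z_plus_Z"
  using hom_in_carrier[OF \<rho>_hom, of k] by (simp add: AutoGroup_def)

lemma \<rho>_add: "\<rho> k (v + w) = \<rho> k v + \<rho> k w"
proof -
  have "\<rho> k \<in> hom Z_plus_Z Z_plus_Z" using \<rho>_auto[of k] by (simp add: auto_def)
  from hom_mult[OF this, of v w] show ?thesis by (simp only: mult_Z_plus_Z) simp
qed

lemma \<rho>_zero: "\<rho> k 0 = 0"
  using \<rho>_add[of k 0 0] by simp

text \<open>Read off from the unit law of the semidirect product; \<open>\<rho>_comp\<close> is
  obtained from associativity in the same way.\<close>

lemma \<rho>_0: "\<rho> 0 v = v"
  using l_one[of "(v, 0)"] by (simp add: carrier_T one_T mult_T)

lemma \<rho>_1: "\<rho> 1 = matrix_action \<theta>"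
proof -
  interpret A: group "AutoGroup Z_plus_Z" by (rule group.AutoGroup[OF group_Z_plus_Z])
  show ?thesis
    unfolding \<rho>_def by (rule A.int_pow_1) (rule matrix_action_AutoGroup[OF invertible_\<theta>])
qed

lemma \<rho>_comp: "\<rho> (k + l) v = \<rho> k (\<rho> l v)"
  using m_assoc[of "(0, k)" "(0, l)" "(v, 0)"] by (simp add: carrier_T mult_T \<rho>_zero)

definition a :: "(int \<times> int) \<times> int" where "a = ((1, 0), 0)"
definition b :: "(int \<times> int) \<times> int" where "b = ((0, 1), 0)"
definition t :: "(int \<times> int) \<times> int" where "t = ((0, 0), 1)"

lemma inv_a: "inv\<^bsub>T\<^esub> a = ((- 1, 0), 0)"
  by (rule inv_equality) (simp_all add: carrier_T a_def mult_T \<rho>_0 one_T zero_prod_def)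

lemma inv_b: "inv\<^bsub>T\<^esub> b = ((0, - 1), 0)"
  by (rule inv_equality) (simp_all add: carrier_T b_def mult_T \<rho>_0 one_T zero_prod_def)

lemma inv_t: "inv\<^bsub>T\<^esub> t = ((0, 0), - 1)"
  using \<rho>_zero[of "- 1"]
  by (intro inv_equality) (simp_all add: carrier_T t_def mult_T one_T flip: zero_prod_def)

lemma generate_fibre: "(v, 0) \<in> generate T {b, a}"
proof -
  have a: "a \<in> generate T {b, a}" "inv\<^bsub>T\<^esub> a \<in> generate T {b, a}"
    and b: "b \<in> generate T {b, a}" "inv\<^bsub>T\<^esub> b \<in> generate T {b, a}"
    by (auto intro: generate.intros)
  have m: "((m, 0), 0) \<in> generate T {b, a}" for m
  proof (induction m rule: int_induct_both)
    case 1
    then show ?case using generate.one[of T] by (simp add: one_T zero_prod_def)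
  next
    case (2 m)
    then show ?case using generate.eng[OF a(1) 2] by (simp add: a_def mult_T \<rho>_0 add.commute)
  next
    case (3 m)
    then show ?case using generate.eng[OF a(2) 3] by (simp add: inv_a mult_T \<rho>_0)
  qed
  have "((m, n), 0) \<in> generate T {b, a}" for m n
  proof (induction n rule: int_induct_both)
    case 1
    then show ?case by (rule m)
  next
    case (2 n)
    then show ?case using generate.eng[OF b(1) 2] by (simp add: b_def mult_T \<rho>_0 add.commute)
  next
    case (3 n)
    then show ?case using generate.eng[OF b(2) 3] by (simp add: inv_b mult_T \<rho>_0)
  qed
  then show ?thesis by (cases v) simp
qed

lemma generate_T: "generate T {t, b, a} = carrier T"
proof -
  have "(v, k) \<in> generate T {t, b, a}" for v k
  proof -
    have t: "t \<in> generate T {t, b, a}" "inv\<^bsub>T\<^esub> t \<in> generate T {t, b, a}"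
      by (auto intro: generate.intros)
    have k: "(0, k) \<in> generate T {t, b, a}" for k
    proof (induction k rule: int_induct_both)
      case 1
      then show ?case using generate.one[of T] by (simp add: one_T)
    next
      case (2 k)
      then show ?case
        using generate.eng[OF t(1) 2] by (simp add: t_def mult_T \<rho>_zero add.commute flip: zero_prod_def)
    next
      case (3 k)
      then show ?case
        using generate.eng[OF t(2) 3] by (simp add: inv_t mult_T \<rho>_zero flip: zero_prod_def)
    qed
    have "(v, 0) \<in> generate T {t, b, a}"
      using generate_fibre mono_generate[of "{b, a}" "{t, b, a}"] by blast
    from generate.eng[OF this k[of k]] show ?thesis by (simp add: mult_T \<rho>_0)
  qed
  then show ?thesis by (auto simp: carrier_T)
qed

section \<open>Orders of cohomology as the generators are adjoined\<close>

abbreviation "h S n \<equiv> cohomology_order list_diff (inv_cochains T S) n"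

text \<open>Starts from the trivial group, with the exponent of \<open>a\<close> as level; the
  orders 2, 1, 1, ... become 2, 2, 1, ....\<close>

lemma h_a: "h {a} n = (if n \<le> 1 then 2 else 1)"
proof -
  have h0: "h {} n = (if n = 0 then 2 else 1)" for n
    by (rule cohomology_order_no_invariance)
  obtain k where k: "h {a} 0 = k 0" "\<And>n. h {a} (Suc n) = k n * k (Suc n)"
    "\<And>n. h {} n \<in> {1, 2} \<Longrightarrow> k n = h {} n"
    by (rule wang_orders[where level = "\<lambda>x. fst (fst x)" and H = "{}" and t = a])
      (auto simp: carrier_T h0 a_def mult_T \<rho>_0 split: prod.splits)
  have "k n = h {} n" for n by (rule k(3)) (simp add: h0)
  then show ?thesis by (cases n) (auto simp: k(1,2) h0)
qed

text \<open>The exponent of \<open>b\<close> is the level, and \<open>b\<close> commutes with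
  \<open>a\<close>. All orders for \<open>a\<close> alone are at most two, so every factor is
  known.\<close>

lemma h_b_a: "h {b, a} n = (if n = 0 \<or> n = 2 then 2 else if n = 1 then 4 else 1)"
proof -
  have comm: "b \<otimes>\<^bsub>T\<^esub> a \<otimes>\<^bsub>T\<^esub> inv\<^bsub>T\<^esub> b = a" "inv\<^bsub>T\<^esub> b \<otimes>\<^bsub>T\<^esub> a \<otimes>\<^bsub>T\<^esub> b = a"
    unfolding inv_b by (simp_all add: a_def b_def mult_T \<rho>_0)
  obtain k where k: "h {b, a} 0 = k 0" "\<And>n. h {b, a} (Suc n) = k n * k (Suc n)"
    "\<And>n. h {a} n \<in> {1, 2} \<Longrightarrow> k n = h {a} n"
  proof (rule wang_orders[where level = "\<lambda>x. snd (fst x)" and H = "{a}" and t = b])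
    show "b \<otimes>\<^bsub>T\<^esub> h \<otimes>\<^bsub>T\<^esub> inv\<^bsub>T\<^esub> b \<in> generate T {a}" if "h \<in> {a}" for h
      using that by (auto simp: comm intro: generate.incl)
    show "inv\<^bsub>T\<^esub> b \<otimes>\<^bsub>T\<^esub> h \<otimes>\<^bsub>T\<^esub> b \<in> generate T {a}" if "h \<in> {a}" for h
      using that by (auto simp: comm intro: generate.incl)
    show "snd (fst (b \<otimes>\<^bsub>T\<^esub> x)) = snd (fst x) + 1" for x
      by (cases x) (simp add: b_def mult_T \<rho>_0)
    show "snd (fst (h \<otimes>\<^bsub>T\<^esub> x)) = snd (fst x)" if "h \<in> {a}" for h x
      using that by (cases x) (simp add: a_def mult_T \<rho>_0)
  qed (auto simp: carrier_T h_a)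
  have kn: "k n = h {a} n" for n by (rule k(3)) (simp add: h_a)
  consider "n = 0" | "n = 1" | "n = 2" | m where "n = Suc (Suc (Suc m))"
    by (metis One_nat_def Suc_1 not0_implies_Suc)
  then show ?thesis
    by cases (simp_all add: k(1,2) kn h_a numeral_2_eq_2)
qed

text \<open>The exponent of \<open>t\<close> is the level. By \<open>h_b_a\<close> every factor
  except \<open>k 1\<close> is forced; degrees 1 and 2 both have order \<open>2 * k 1\<close>, which
  is why only their equality is obtained here.\<close>

lemma h_T:
  fixes n :: nat
  shows "h (carrier T) 0 = 2" "h (carrier T) 2 = h (carrier T) 1" "h (carrier T) 3 = 2"
    and "n \<ge> 4 \<Longrightarrow> h (carrier T) n = 1"
proof -
  have snd_mult: "snd (x \<otimes>\<^bsub>T\<^esub> y) = snd x + snd y" for x y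
    by (cases x; cases y) (simp add: mult_T)
  have snd: "snd a = 0" "snd b = 0" "snd t = 1" "snd (inv\<^bsub>T\<^esub> t) = - 1"
    by (simp_all only: inv_t snd_conv) (simp_all add: a_def b_def t_def)
  have fibre: "x \<in> generate T {b, a}" if "snd x = 0" for x
    using generate_fibre[of "fst x"] that by (cases x) simp
  obtain k where k: "h {t, b, a} 0 = k 0" "\<And>n. h {t, b, a} (Suc n) = k n * k (Suc n)"
    "\<And>n. h {b, a} n \<in> {1, 2} \<Longrightarrow> k n = h {b, a} n"
  proof (rule wang_orders[where level = snd and H = "{b, a}" and t = t])
    show "t \<otimes>\<^bsub>T\<^esub> h \<otimes>\<^bsub>T\<^esub> inv\<^bsub>T\<^esub> t \<in> generate T {b, a}" if "h \<in> {b, a}" for h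
      using that by (intro fibre) (auto simp: snd_mult snd)
    show "inv\<^bsub>T\<^esub> t \<otimes>\<^bsub>T\<^esub> h \<otimes>\<^bsub>T\<^esub> t \<in> generate T {b, a}" if "h \<in> {b, a}" for h
      using that by (intro fibre) (auto simp: snd_mult snd)
  qed (auto simp: carrier_T h_b_a snd_mult snd)
  have "inv_cochains T {t, b, a} = inv_cochains T (carrier T)"
    using inv_cochains_generate[of "{t, b, a}"] by (simp add: carrier_T generate_T fun_eq_iff)
  then have T: "h (carrier T) = h {t, b, a}" by simp
  have k': "k 0 = 2" "k 2 = 2" "\<And>n. n \<ge> 3 \<Longrightarrow> k n = 1"
    using k(3)[of 0] k(3)[of 2] k(3) by (simp_all add: h_b_a)
  show "h (carrier T) 0 = 2" by (simp add: T k k')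
  show "h (carrier T) 2 = h (carrier T) 1"
    using k(2)[of 0] k(2)[of 1] k' by (simp add: T numeral_2_eq_2)
  show "h (carrier T) 3 = 2"
    using k(2)[of 2] k' by (simp add: T numeral_3_eq_3 numeral_2_eq_2)
  show "h (carrier T) n = 1" if "n \<ge> 4"
    using k(2)[of "n - 1"] k'(3)[of "n - 1"] k'(3)[of n] that by (simp add: T)
qed

end

section \<open>The first cohomology group\<close>

definition bit_homs :: "('g, 'b) monoid_scheme \<Rightarrow> ('g \<Rightarrow> bit) set" where
  "bit_homs G = {\<psi>. \<forall>x y. \<psi> (x \<otimes>\<^bsub>G\<^esub> y) = \<psi> x + \<psi> y}"

context group
begin

text \<open>Invariant 0-cochains are constant, so there are no nonzero 1-coboundaries. A 1-cocycle
  \<open>F\<close> corresponds to the homomorphism sending x to \<open>F [\<one>, x]\<close>, with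
  inverse construction \<psi>(x^-1 y).\<close>

lemma cohomology_order_1:
  assumes UNIV: "carrier G = UNIV"
  shows "cohomology_order list_diff (inv_cochains G (carrier G)) 1 = card (bit_homs G)"
proof -
  let ?E = "inv_cochains G (carrier G)"
  interpret cochain_complex list_diff ?E by (rule cochain_complex_inv_cochains)
  have inv: "F (map ((\<otimes>) g) xs) = F xs" if "F \<in> ?E n" for F g xs n
    using that by (simp add: inv_cochains_def UNIV)
  have "list_diff F = 0" if F: "F \<in> ?E 0" for F
  proof
    fix xs
    have const: "F [x] = F [\<one>]" for x using inv[OF F, of x "[\<one>]"] by (simp add: UNIV)
    have "list_diff F xs = 0" if len: "length xs = 2"
    proof -
      obtain x y where "xs = [x, y]" using len by (auto simp: length_Suc_conv numeral_2_eq_2)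
      moreover have "F [] = 0" using F by (simp add: inv_cochains_def)
      ultimately show ?thesis using const[of x] const[of y] by (simp add: bit_add_self)
    qed
    moreover have "list_diff F xs = 0" if "length xs \<noteq> 2"
      by (rule list_diff_supported[of 1]) (use that F in \<open>auto simp: inv_cochains_def\<close>)
    ultimately show "list_diff F xs = 0 xs" by auto
  qed
  then have "B 1 = {0}"
    using add_subgroup_zero[OF add_subgroup_E[of 0]] by (force simp: coboundary_group_def)
  moreover have "bij_betw (\<lambda>F x. F [\<one>, x]) (Z 1) (bit_homs G)"
  proof (rule bij_betw_byWitness[where f' = "\<lambda>\<psi> xs. case xs of [x, y] \<Rightarrow> \<psi> (inv x \<otimes> y) | _ \<Rightarrow> 0"])
    have *: "F [x, y] = F [\<one>, inv x \<otimes> y]" if "F \<in> Z 1" for F x y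
      using inv[of F 1 "inv x" "[x, y]"] that by (simp add: cocycle_group_def UNIV)
    show "\<forall>F\<in>Z 1. (\<lambda>xs. case xs of [x, y] \<Rightarrow> F [\<one>, inv x \<otimes> y] | _ \<Rightarrow> 0) = F"
    proof (intro ballI ext)
      fix F xs assume F: "F \<in> Z 1"
      show "(case xs of [x, y] \<Rightarrow> F [\<one>, inv x \<otimes> y] | _ \<Rightarrow> 0) = F xs"
      proof (cases "length xs = 2")
        case True
        then obtain x y where "xs = [x, y]" by (auto simp: length_Suc_conv numeral_2_eq_2)
        then show ?thesis using *[OF F, of x y] by simp
      next
        case False
        then have "F xs = 0" using F by (simp add: cocycle_group_def inv_cochains_def)
        then show ?thesis using False by (auto split: list.split)
      qed
    qed
    show "\<forall>\<psi>\<in>bit_homs G. (\<lambda>x. case [\<one>, x] of [x, y] \<Rightarrow> \<psi> (inv x \<otimes> y) | _ \<Rightarrow> 0) = \<psi>"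
      by (simp add: UNIV)
    show "(\<lambda>F x. F [\<one>, x]) ` Z 1 \<subseteq> bit_homs G"
    proof (intro image_subsetI)
      fix F assume F: "F \<in> Z 1"
      have "F [\<one>, x \<otimes> y] = F [\<one>, x] + F [\<one>, y]" for x y
      proof -
        \<comment> \<open>The cocycle condition on this triple is additivity, after the face without
          \<one> is translated back to the identity.\<close>
        have "list_diff F [\<one>, x, x \<otimes> y] = 0" using F by (simp add: cocycle_group_def)
        moreover have "F [] = 0" "F [\<one>] = 0" "F [x] = 0" "F [x \<otimes> y] = 0"
          using F by (simp_all add: cocycle_group_def inv_cochains_def)
        moreover have "F [x, x \<otimes> y] = F [\<one>, y]"
          using *[OF F, of x "x \<otimes> y"] by (simp add: UNIV flip: m_assoc)
        ultimately have "F [\<one>, y] + (F [\<one>, x \<otimes> y] + F [\<one>, x]) = 0"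
          by simp
        then have "F [\<one>, y] = F [\<one>, x \<otimes> y] + F [\<one>, x]" by (simp only: bit_add_eq_0_iff)
        then show ?thesis by (cases "F [\<one>, x]"; cases "F [\<one>, y]"; cases "F [\<one>, x \<otimes> y]") simp_all
      qed
      then show "(\<lambda>x. F [\<one>, x]) \<in> bit_homs G" by (simp add: bit_homs_def)
    qed
    show "(\<lambda>\<psi> xs. case xs of [x, y] \<Rightarrow> \<psi> (inv x \<otimes> y) | _ \<Rightarrow> 0) ` bit_homs G \<subseteq> Z 1"
    proof (intro image_subsetI)
      fix \<psi> assume "\<psi> \<in> bit_homs G"
      then have \<psi>: "\<psi> (x \<otimes> y) = \<psi> x + \<psi> y" for x y by (simp add: bit_homs_def)
      let ?F = "\<lambda>xs. case xs of [x, y] \<Rightarrow> \<psi> (inv x \<otimes> y) | _ \<Rightarrow> 0"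
      have supp: "?F xs = 0" if "length xs \<noteq> Suc 1" for xs
        using that by (auto split: list.split)
      have "\<psi> \<one> = 0" using \<psi>[of \<one> \<one>] by (simp add: UNIV bit_add_self)
      then have \<psi>_inv: "\<psi> (inv x) = \<psi> x" for x
        using \<psi>[of "inv x" x] by (simp add: UNIV bit_add_eq_0_iff)
      have "?F (map ((\<otimes>) g) xs) = ?F xs" for g xs
      proof (cases "length xs = 2")
        case True
        then obtain x y where "xs = [x, y]" by (auto simp: length_Suc_conv numeral_2_eq_2)
        moreover have "inv (g \<otimes> x) \<otimes> (g \<otimes> y) = inv x \<otimes> y"
          using quotients_translate[OF UNIV, of g "[x, y]"] by simp
        ultimately show ?thesis by simp
      next
        case False
        then show ?thesis by (subst (1 2) supp) auto
      qed
      then have E: "?F \<in> ?E 1" using supp by (simp add: inv_cochains_def)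
      have "list_diff ?F xs = 0" for xs
      proof (cases "length xs = 3")
        case True
        then obtain x y z where "xs = [x, y, z]" by (auto simp: length_Suc_conv numeral_3_eq_3)
        then show ?thesis
          by (cases "\<psi> x"; cases "\<psi> y"; cases "\<psi> z") (simp_all add: \<psi> \<psi>_inv)
      next
        case False
        then show ?thesis by (intro list_diff_supported[of "Suc 1"] supp) auto
      qed
      then show "?F \<in> Z 1" using E by (simp add: cocycle_group_def fun_eq_iff)
    qed
  qed
  ultimately show ?thesis
    by (simp add: cohomology_order_def coset_index_zero bij_betw_same_card)
qed

lemma bit_homs_eq_on_generators:
  assumes UNIV: "carrier G = UNIV" and gen: "generate G S = carrier G"
    and \<psi>: "\<psi> \<in> bit_homs G" "\<psi>' \<in> bit_homs G" and eq: "\<And>s. s \<in> S \<Longrightarrow> \<psi> s = \<psi>' s"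
  shows "\<psi> = \<psi>'"
proof
  fix x
  have one: "\<omega> \<one> = 0" if "\<omega> \<in> bit_homs G" for \<omega>
  proof -
    have "\<omega> (\<one> \<otimes> \<one>) = \<omega> \<one> + \<omega> \<one>" using that by (simp only: bit_homs_def mem_Collect_eq)
    then show ?thesis by (simp add: UNIV bit_add_self)
  qed
  have inv: "\<omega> (inv x) = \<omega> x" if "\<omega> \<in> bit_homs G" for \<omega> x
  proof -
    have "\<omega> (inv x \<otimes> x) = \<omega> (inv x) + \<omega> x" using that by (simp only: bit_homs_def mem_Collect_eq)
    then show ?thesis using one[OF that] by (simp add: UNIV bit_add_eq_0_iff)
  qed
  have "x \<in> generate G S" using gen UNIV by simp
  then show "\<psi> x = \<psi>' x"
  proof induction
    case (eng h1 h2)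
    then show ?case using \<psi> by (simp add: bit_homs_def)
  qed (simp_all add: eq inv[OF \<psi>(1)] inv[OF \<psi>(2)] one[OF \<psi>(1)] one[OF \<psi>(2)])
qed

end

text \<open>Rank-nullity for the left kernel. Over two elements the span of y is {0, y}, so rank and
  relations depend only on which rows vanish and whether they agree.\<close>

lemma card_bit_row_relations:
  fixes A :: "bit^2^2"
  shows "card {(u, v). u *s row 1 A + v *s row 2 A = 0} = 2 ^ (2 - rank A)" and "rank A \<le> 2"
proof -
  have rows: "rows A = {row 1 A, row 2 A}"
    by (auto simp: rows_def) (metis exhaust_2)
  have span: "vec.span {y} = {0, y}" for y :: "bit^2"
  proof -
    have "vec.span {y} = range (\<lambda>k. k *s y)" by (rule vec.span_singleton)
    also have "\<dots> = {0, y}"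
    proof (intro equalityI subsetI)
      fix z assume "z \<in> range (\<lambda>k. k *s y)"
      then obtain k where "z = k *s y" by blast
      then show "z \<in> {0, y}" by (cases k) simp_all
    next
      fix z assume "z \<in> {0, y}"
      then have "z = 0 *s y \<or> z = 1 *s y" by simp
      then show "z \<in> range (\<lambda>k. k *s y)" by blast
    qed
    finally show ?thesis .
  qed
  have "y + y = 0" for y :: "bit^2" by (simp add: vec_eq_iff bit_add_self)
  then have add_0: "y + z = 0 \<longleftrightarrow> y = z" for y z :: "bit^2"
    by (metis add_diff_cancel_left')
  let ?r = "row 1 A" and ?s = "row 2 A"
  have rank: "rank A = (if ?r \<in> vec.span {?s} then 0 else 1) + (if ?s = 0 then 0 else 1)"
    unfolding row_rank_def_gen rows by (simp add: vec.dim_insert)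
  have "{(u, v). u *s ?r + v *s ?s = 0} =
     {(0, 0)} \<union> (if ?s = 0 then {(0, 1)} else {}) \<union> (if ?r = 0 then {(1, 0)} else {}) \<union>
     (if ?r = ?s then {(1, 1)} else {})" (is "?L = ?R")
  proof (rule Set.set_eqI)
    fix p :: "bit \<times> bit"
    obtain u v where "p = (u, v)" by (cases p)
    then show "p \<in> ?L \<longleftrightarrow> p \<in> ?R" by (cases u; cases v) (auto simp: add_0)
  qed
  then show "card {(u, v). u *s ?r + v *s ?s = 0} = 2 ^ (2 - rank A)"
    by (auto simp: rank span)
  show "rank A \<le> 2" by (simp add: rank)
qed

context torus_bundle
begin

text \<open>A homomorphism is given by its values u, v, w on \<open>a\<close>, \<open>b\<close>,
  \<open>t\<close>. The value w is free, while the row vector (u, v) must be killed by \<theta> - I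
  modulo two; this leaves 1 + (2 - rank) dimensions.\<close>

lemma card_bit_homs: "card (bit_homs T) = 2 ^ (3 - rank_mod_2 (\<theta> - mat 1))"
proof -
  let ?A = "map_matrix of_int (\<theta> - mat 1) :: bit^2^2"
  let ?R = "{(u, v). u *s row 1 ?A + v *s row 2 ?A = 0}"
  \<comment> \<open>The linear extension to the fibre of the values u on \<open>a\<close> and v on
    \<open>b\<close>; the relations in \<open>?R\<close> say that it is unchanged by
    \<theta>.\<close>
  define L where "L = (\<lambda>(u, v) (m, n). of_int m * u + of_int n * v :: bit)"
  have R_iff: "(u, v) \<in> ?R \<longleftrightarrow>
      L (u, v) (matrix_action \<theta> (1, 0)) = u \<and> L (u, v) (matrix_action \<theta> (0, 1)) = v" for u v
  proof -
    have minus: "y - z = y + z" for y z :: bit by (rule bit_diff_eq_add)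
    have one: "1 + y = z \<longleftrightarrow> y + z = 1" "y = 1 + z \<longleftrightarrow> y + z = 1" for y z :: bit
      by (cases y; cases z; simp)+
    show ?thesis
      by (cases u; cases v)
        (auto simp: L_def matrix_action_apply row_def map_matrix_def mat_def vec_eq_iff forall_2
          minus one bit_add_eq_0_iff add.assoc add.commute add.left_commute)
  qed
  have L_add: "L p (x + y) = L p x + L p y" for p x y
    by (cases p; cases x; cases y) (simp add: L_def algebra_simps)
  have L_\<rho>: "L p (\<rho> k x) = L p x" if p: "p \<in> ?R" for p k x
  proof -
    obtain u v where p': "p = (u, v)" by (cases p)
    have 1: "L p (\<rho> 1 x) = L p x" for x
    proof -
      obtain m n where x: "x = (m, n)" by (cases x)
      have "matrix_action \<theta> (m, n) = (\<theta>$1$1 * m + \<theta>$1$2 * n, \<theta>$2$1 * m + \<theta>$2$2 * n)"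
        by (rule matrix_action_apply)
      then have "L p (\<rho> 1 x) = of_int m * L p (matrix_action \<theta> (1, 0)) + of_int n * L p (matrix_action \<theta> (0, 1))"
        by (simp add: p' x \<rho>_1 L_def matrix_action_apply algebra_simps)
      then show ?thesis using p R_iff[of u v] by (simp add: p' x) (simp add: L_def)
    qed
    show ?thesis
    proof (induction k arbitrary: x rule: int_induct_both)
      case 1
      then show ?case by (simp add: \<rho>_0)
    next
      case (2 k)
      then show ?case by (simp add: \<rho>_comp 1)
    next
      case (3 k)
      \<comment> \<open>The downward step uses invariance under \<open>\<rho> 1\<close> at the point
        \<open>\<rho> (k - 1) x\<close>, so the inverse matrix never has to be computed.\<close>
      have "L p (\<rho> (k - 1) x) = L p (\<rho> 1 (\<rho> (k - 1) x))" by (simp only: 1)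
      also have "\<dots> = L p (\<rho> k x)" by (simp flip: \<rho>_comp)
      finally show ?case using 3 by simp
    qed
  qed
  have "bij_betw (\<lambda>\<psi>. ((\<psi> a, \<psi> b), \<psi> t)) (bit_homs T) (?R \<times> UNIV)"
    unfolding bij_betw_def
  proof
    show "inj_on (\<lambda>\<psi>. ((\<psi> a, \<psi> b), \<psi> t)) (bit_homs T)"
      by (rule inj_onI) (rule bit_homs_eq_on_generators[OF carrier_T generate_T], auto)
    show "(\<lambda>\<psi>. ((\<psi> a, \<psi> b), \<psi> t)) ` bit_homs T = ?R \<times> UNIV"
    proof (intro equalityI subsetI)
      fix q assume "q \<in> (\<lambda>\<psi>. ((\<psi> a, \<psi> b), \<psi> t)) ` bit_homs T"
      then obtain \<psi> where \<psi>: "\<psi> \<in> bit_homs T" and q: "q = ((\<psi> a, \<psi> b), \<psi> t)" by blast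
      have mult: "\<psi> (x \<otimes>\<^bsub>T\<^esub> y) = \<psi> x + \<psi> y" for x y using \<psi> by (simp only: bit_homs_def mem_Collect_eq)
      have add: "\<psi> (v + w, 0) = \<psi> (v, 0) + \<psi> (w, 0)" for v w
        using mult[of "(v, 0)" "(w, 0)"] by (simp add: mult_T \<rho>_0)
      have zero: "\<psi> (0, 0) = 0" using add[of 0 0] by (simp add: bit_add_self)
      have lin: "\<psi> ((m, n), 0) = L (\<psi> a, \<psi> b) (m, n)" for m n
      proof -
        have m: "\<psi> ((m, 0), 0) = of_int m * \<psi> a" for m
        proof (induction m rule: int_induct_both)
          case 1
          then show ?case using zero by (simp add: zero_prod_def)
        next
          case (2 m)
          then show ?case using add[of "(m, 0)" "(1, 0)"] by (simp add: a_def algebra_simps)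
        next
          case (3 m)
          then show ?case using add[of "(m - 1, 0)" "(1, 0)"] by (simp add: a_def algebra_simps)
        qed
        have n: "\<psi> ((0, n), 0) = of_int n * \<psi> b" for n
        proof (induction n rule: int_induct_both)
          case 1
          then show ?case using zero by (simp add: zero_prod_def)
        next
          case (2 m)
          then show ?case using add[of "(0, m)" "(0, 1)"] by (simp add: b_def algebra_simps)
        next
          case (3 m)
          then show ?case using add[of "(0, m - 1)" "(0, 1)"] by (simp add: b_def algebra_simps)
        qed
        show ?thesis using add[of "(m, 0)" "(0, n)"] by (simp add: m n L_def)
      qed
      \<comment> \<open>Conjugation by \<open>t\<close> acts on the fibre as \<theta> and is
        invisible in an abelian target.\<close>
      have conj: "\<psi> (\<rho> 1 v, 0) = \<psi> (v, 0)" for v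
      proof -
        have "t \<otimes>\<^bsub>T\<^esub> (v, 0) = (\<rho> 1 v, 0) \<otimes>\<^bsub>T\<^esub> t"
          by (simp add: t_def mult_T \<rho>_0 \<rho>_zero flip: zero_prod_def)
        then have "\<psi> t + \<psi> (v, 0) = \<psi> (\<rho> 1 v, 0) + \<psi> t" by (simp flip: mult)
        then show ?thesis by simp
      qed
      have "L (\<psi> a, \<psi> b) (matrix_action \<theta> v) = L (\<psi> a, \<psi> b) v" for v
        using conj[of v] by (cases v; cases "matrix_action \<theta> v") (simp add: \<rho>_1 lin)
      then have "(\<psi> a, \<psi> b) \<in> ?R" unfolding R_iff by (simp add: L_def)
      then show "q \<in> ?R \<times> UNIV" by (simp add: q)
    next
      fix q assume "q \<in> ?R \<times> (UNIV :: bit set)"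
      then obtain p w where q: "q = (p, w)" and p: "p \<in> ?R" by blast
      define \<psi> where "\<psi> = (\<lambda>(v, k). L p v + of_int k * w)"
      have "\<psi> \<in> bit_homs T"
        by (auto simp: bit_homs_def \<psi>_def mult_T L_add L_\<rho>[OF p] algebra_simps)
      moreover have "((\<psi> a, \<psi> b), \<psi> t) = q"
        by (cases p) (simp add: q \<psi>_def a_def b_def t_def L_def)
      ultimately show "q \<in> (\<lambda>\<psi>. ((\<psi> a, \<psi> b), \<psi> t)) ` bit_homs T" by force
    qed
  qed
  then have "card (bit_homs T) = card ?R * card (UNIV :: bit set)"
    by (simp only: bij_betw_same_card card_cartesian_product)
  also have "(UNIV :: bit set) = {0, 1}" using bit.exhaust by auto
  also have "card ?R * card {0, 1 :: bit} = 2 ^ Suc (2 - rank ?A)"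
    using card_bit_row_relations(1)[of ?A] by simp
  also have "Suc (2 - rank ?A) = 3 - rank ?A"
    using card_bit_row_relations(2)[of ?A] by simp
  finally show ?thesis by (simp only: rank_mod_2_def)
qed

lemma cohomology_T_iso:
  assumes "h (carrier T) n = 2 ^ r"
  shows "group_cohomology n T trivial_action (integer_mod_group 2) \<cong> Z2_power r"
  using group_cohomology_order[OF carrier_T, where n = n] assms
  by (intro comm_group.exponent_two_iso_Z2_power) simp_all

end

theorem theorem4:
  fixes \<alpha> \<beta> \<gamma> \<delta> :: int and \<theta> :: "int^2^2"
  assumes "\<theta> = vector [vector [\<alpha>, \<gamma>], vector [\<beta>, \<delta>]]"
    and "invertible \<theta>"
  shows "group_cohomology 0 (torus_bundle_group \<theta>) trivial_action (integer_mod_group 2)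
           \<cong> integer_mod_group 2 \<and>
         group_cohomology 1 (torus_bundle_group \<theta>) trivial_action (integer_mod_group 2)
           \<cong> Z2_power (3 - rank_mod_2 (\<theta> - mat 1)) \<and>
         group_cohomology 2 (torus_bundle_group \<theta>) trivial_action (integer_mod_group 2)
           \<cong> Z2_power (3 - rank_mod_2 (\<theta> - mat 1)) \<and>
         group_cohomology 3 (torus_bundle_group \<theta>) trivial_action (integer_mod_group 2)
           \<cong> integer_mod_group 2 \<and>
         (\<forall>n\<ge>4. trivial_group
           (group_cohomology n (torus_bundle_group \<theta>) trivial_action (integer_mod_group 2)))"
proof -
  interpret torus_bundle \<theta> by unfold_locales (rule assms(2))
  let ?H = "\<lambda>n. group_cohomology n T trivial_action (integer_mod_group 2)"
  have Z2: "Z2_power 1 \<cong> integer_mod_group 2"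
    by (rule group.iso_sym[OF group_integer_mod_group Z2_iso_Z2_power_1])
  \<comment> \<open>Counting homomorphisms settles degree 1 and with it degree 2, which has the same
    order.\<close>
  have 1: "h (carrier T) 1 = 2 ^ (3 - rank_mod_2 (\<theta> - mat 1))"
    by (simp only: cohomology_order_1[OF carrier_T] card_bit_homs)
  have "?H 0 \<cong> integer_mod_group 2" "?H 3 \<cong> integer_mod_group 2"
    by (rule iso_trans[OF cohomology_T_iso Z2], simp add: h_T)+
  moreover have "?H 1 \<cong> Z2_power (3 - rank_mod_2 (\<theta> - mat 1))"
    by (rule cohomology_T_iso[OF 1])
  moreover have "?H 2 \<cong> Z2_power (3 - rank_mod_2 (\<theta> - mat 1))"
    by (rule cohomology_T_iso) (simp only: h_T(2) 1)
  moreover have "trivial_group (?H n)" if "n \<ge> 4" for n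
  proof -
    interpret H: comm_group "?H n" by (rule group_cohomology_order(1)[OF carrier_T])
    have "order (?H n) = 1" by (simp only: group_cohomology_order(3)[OF carrier_T] h_T(4)[OF that])
    then show ?thesis by (simp only: H.order_one_triv_iff trivial_group_def H.is_group)
  qed
  ultimately show ?thesis by blast
qed

end
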